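(* Let $n\ge0$ and $m\ge1$ be integers. Then $$\prod_{1\le i<j\le m}(1-x_ix_j)\,P_n(x_1,\dots,x_m)=(-1)^{\binom m2}q^{(n+1)\binom m2+2\binom m3}\frac{(-q;q)_n^m}{(q;q)_{m+n-1}^m}\prod_{i=1}^m\frac{(q^{n+1-m+i};q)_{i-1}}{(-q^{2-m};q)_{i-1}}$$ $$\times\sum_{k_1,\dots,k_m=0}^{n+m-1}\left(\prod_{1\le i<j\le m}(q^{k_j}-q^{k_i})(1-q^{k_i+k_j+1-m-n})\prod_{i=1}^m\frac{(q^{1-m-n},-q^{2-m};q)_{k_i}}{(q,-q^{-n};q)_{k_i}}\,x_i^{k_i}\right).$$
   Context: $q$ is a generic complex parameter: $q\neq 0$ and $q$ is not a root of unity. $(a;q)_k=(1-a)(1-aq)\cdots(1-aq^{k-1})$ and $(a_1,\dots,a_r;q)_k=(a_1;q)_k\cdots(a_r;q)_k$. For integers $n\ge 0$, $m\ge1$, $$P_n(x_1,\dots,x_m)=\frac{(-q;q)_n^m}{(q;q)_n^m}\sum_{k_1,\dots,k_m=0}^n\ \prod_{1\le i<j\le m}\frac{q^{k_j}-q^{k_i}}{q^{k_j}+q^{k_i}}\prod_{i=1}^m\frac{(-q,q^{-n};q)_{k_i}}{(q,-q^{-n};q)_{k_i}}\,x_i^{k_i}.$$ *)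

theory Defs
  imports Complex_Main "HOL-Library.FuncSet"
begin

text \<open>The q-shifted factorial $(a;q)_k$. In what follows $(a,b;q)_k$ is written out as
  $(a;q)_k\,(b;q)_k$.\<close>

definition qpoch :: "complex \<Rightarrow> complex \<Rightarrow> nat \<Rightarrow> complex" where
  "qpoch a q k = (\<Prod>l<k. 1 - a * q ^ l)"

definition generic_q :: "complex \<Rightarrow> bool" where
  "generic_q q \<longleftrightarrow> q \<noteq> 0 \<and> (\<forall>r::nat. r \<ge> 1 \<longrightarrow> q ^ r \<noteq> 1)"

text \<open>$P_n(x_1,\dots,x_m)$. Only the values of \<open>x\<close> on \<open>{1..m}\<close> matter. The multiple sum over
  $k_1,\dots,k_m$ runs over the extensional functions on \<open>{1..m}\<close>, so that every tuple is
  counted once.\<close>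

definition P :: "complex \<Rightarrow> nat \<Rightarrow> nat \<Rightarrow> (nat \<Rightarrow> complex) \<Rightarrow> complex" where
  "P q n m x =
     qpoch (- q) q n ^ m / qpoch q q n ^ m *
     (\<Sum>k \<in> PiE {1..m} (\<lambda>_. {0..n}).
        (\<Prod>i\<in>{1..m}. \<Prod>j\<in>{i<..m}. (q ^ k j - q ^ k i) / (q ^ k j + q ^ k i)) *
        (\<Prod>i\<in>{1..m}.
           (qpoch (- q) q (k i) * qpoch (q powi (- int n)) q (k i)) /
           (qpoch q q (k i) * qpoch (- (q powi (- int n))) q (k i)) * x i ^ k i))"

end

theory Submission
  imports Defs "HOL-Computational_Algebra.Polynomial" "HOL-Analysis.Elementary_Topology"
begin

text \<open>
  Put \<open>m = M + 1\<close> and \<open>N = n + M\<close>. If \<open>n < M\<close>, both sides are zero, since in each summand one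
  of the factors indexed by pairs is zero (\<open>psum_eq_0_if_few\<close>, \<open>gsum_eq_0_if_few\<close>). If
  \<open>M \<le> n\<close>, the identity is proved by induction on \<open>M\<close>, with \<open>n\<close> lowered together with \<open>M\<close>. The idea is
  to fix \<open>x\<^sub>1, \<dots>, x\<^sub>M\<close> and to regard both sides as polynomials in the last variable \<open>t = x\<^sub>m\<close>.

  Let \<open>w\<^sub>k\<close> be the weight of the sum on the right. On both sides the coefficient of \<open>t\<^sup>k\<close> is
  \<open>w\<^sub>k\<close> times the value at \<open>q\<^sup>k\<close> of a polynomial of degree at most \<open>2M\<close>, which does not depend on \<open>k\<close>
  (\<open>psum_wspan\<close>, for nonzero \<open>x\<^sub>i\<close>, and \<open>gsum_wspan\<close>). On the right this is
  visible from the product over pairs. On the left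
  the coefficient is a rational function of \<open>q\<^sup>k\<close> with candidate poles at \<open>- q\<^sup>p\<close> for \<open>M \<le> p \<le> n\<close>. The
  residue there is a combination, over \<open>i \<le> M\<close>, of the sums
  \<open>\<Sum>\<^sub>s e\<^sub>s x\<^sub>i\<^bsup>p-s\<^esup>\<close>, where \<open>\<Prod>\<^sub>i (1 - x\<^sub>i t) = \<Sum>\<^sub>s e\<^sub>s t\<^sup>s\<close>, and each of them is zero because
  \<open>1 / x\<^sub>i\<close> is a root of that product.

  Polynomials in \<open>t\<close> with such coefficients form a space of dimension at most \<open>2M + 1\<close>, and, because
  \<open>w\<close> is well-poised, this space is stable under the reflection \<open>f(t) \<mapsto> t\<^sup>N f(1/t)\<close>. It splits into an
  antisymmetric part, spanned by \<open>M\<close> elements, and a symmetric part, spanned by \<open>M + 1\<close> elements.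
  Both sides of the identity vanish at \<open>t = x\<^sub>i\<close>, by antisymmetry in the variables, and at
  \<open>t = 1 / x\<^sub>i\<close>, by the factors \<open>1 - x\<^sub>i x\<^sub>j\<close> on the left and by reflection on the right. At a generic
  point \<open>(x\<^sub>1, \<dots>, x\<^sub>M)\<close> an element of a fixed space spanned by \<open>M\<close> polynomials that vanishes at all
  \<open>x\<^sub>i\<close> is zero, and continuity extends this to every point (\<open>generic_interpolation_zero\<close>). This kills
  the antisymmetric part of the difference of the two sides (\<open>wspan_reflection\<close>). The same argument
  kills the symmetric part as soon as one more linear condition is known, and this condition is the
  value at \<open>t = 0\<close> (\<open>wspan_eq_0\<close>): there both sides reduce to the same identity with \<open>(n - 1, M - 1)\<close>
  in place of \<open>(n, M)\<close>, up to elementary factors and the monomial \<open>x\<^sub>1 \<cdots> x\<^sub>M\<close> (\<open>psum_at_0\<close>,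
  \<open>gsum_at_0\<close>). The constant on the right satisfies the recursion that these factors
  require (\<open>rhs_const_step\<close>).
\<close>

section \<open>Products over ordered pairs and alternating sums\<close>

definition pairprod :: "nat set \<Rightarrow> (nat \<Rightarrow> nat \<Rightarrow> complex) \<Rightarrow> complex" where
  "pairprod I f = (\<Prod>i\<in>I. \<Prod>j\<in>{j\<in>I. i < j}. f i j)"

text \<open>The sign that a skew factor picks up when the pair \<open>(i, j)\<close> is put into increasing order.\<close>

definition psgn :: "nat \<Rightarrow> nat \<Rightarrow> complex" where
  "psgn i j = (if i < j then 1 else -1)"

lemma pairprod_cong:
  assumes "I = J" "\<And>i j. i \<in> J \<Longrightarrow> j \<in> J \<Longrightarrow> i < j \<Longrightarrow> f i j = g i j"
  shows "pairprod I f = pairprod J g"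
  unfolding pairprod_def using assms by (intro prod.cong) auto

lemma pairprod_mult: "pairprod I (\<lambda>i j. f i j * g i j) = pairprod I f * pairprod I g"
  unfolding pairprod_def by (simp add: prod.distrib)

lemma pairprod_atLeastAtMost:
  "pairprod {1..m} f = (\<Prod>i\<in>{1..m}. \<Prod>j\<in>{i<..m}. f i j)"
  unfolding pairprod_def by (intro prod.cong refl) auto

lemma pairprod_remove:
  assumes "finite I" "i \<in> I"
  shows "pairprod I f = pairprod (I - {i}) f * (\<Prod>a\<in>I - {i}. if i < a then f i a else f a i)"
proof -
  let ?J = "I - {i}"
  have fin: "finite ?J" using assms by simp
  have row: "(\<Prod>j\<in>{j\<in>I. a < j}. f a j) =
      (\<Prod>j\<in>{j\<in>?J. a < j}. f a j) * (if i < a then 1 else f a i)" if "a \<in> ?J" for a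
  proof (cases "a < i")
    case True
    have "{j\<in>I. a < j} = insert i {j\<in>?J. a < j}" using True assms by auto
    then show ?thesis using True fin by (simp add: mult.commute)
  next
    case False
    have "{j\<in>I. a < j} = {j\<in>?J. a < j}" using False by auto
    then show ?thesis using False that by auto
  qed
  have "pairprod I f = (\<Prod>j\<in>{j\<in>I. i < j}. f i j) * (\<Prod>a\<in>?J. \<Prod>j\<in>{j\<in>I. a < j}. f a j)"
    unfolding pairprod_def using assms by (simp add: prod.remove)
  also have "{j\<in>I. i < j} = {j\<in>?J. i < j}" by auto
  also have "(\<Prod>j\<in>{j\<in>?J. i < j}. f i j) = (\<Prod>a\<in>?J. if i < a then f i a else 1)"
    using fin by (subst prod.inter_filter[symmetric]) auto
  also have "(\<Prod>a\<in>?J. \<Prod>j\<in>{j\<in>I. a < j}. f a j) =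
      pairprod ?J f * (\<Prod>a\<in>?J. if i < a then 1 else f a i)"
    unfolding pairprod_def prod.distrib[symmetric] using row by (intro prod.cong) auto
  finally have "pairprod I f = pairprod ?J f *
     ((\<Prod>a\<in>?J. if i < a then f i a else 1) * (\<Prod>a\<in>?J. if i < a then 1 else f a i))"
    by (simp add: mult_ac)
  also have "(\<Prod>a\<in>?J. if i < a then f i a else 1) * (\<Prod>a\<in>?J. if i < a then 1 else f a i) =
     (\<Prod>a\<in>?J. if i < a then f i a else f a i)"
    unfolding prod.distrib[symmetric] by (intro prod.cong) auto
  finally show ?thesis .
qed

lemma pairprod_insert_max:
  assumes "finite I" "\<forall>i\<in>I. i < m"
  shows "pairprod (insert m I) f = pairprod I f * (\<Prod>i\<in>I. f i m)"
proof -
  have "insert m I - {m} = I" using assms by auto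
  moreover have "(\<Prod>a\<in>I. if m < a then f m a else f a m) = (\<Prod>i\<in>I. f i m)"
    using assms by (intro prod.cong) (auto dest: less_asym)
  ultimately show ?thesis using pairprod_remove[of "insert m I" m f] assms by simp
qed

lemma pairprod_remove_skew:
  assumes "finite I" "i \<in> I" "\<And>a b. f a b = - f b a"
  shows "pairprod I f = pairprod (I - {i}) f * (\<Prod>a\<in>I - {i}. psgn i a * f i a)"
proof -
  have "(if i < a then f i a else f a i) = psgn i a * f i a" for a
    using assms(3)[of a i] by (auto simp: psgn_def)
  then show ?thesis using pairprod_remove[OF assms(1,2), of f] by simp
qed

lemma psgn_skew: "i \<noteq> j \<Longrightarrow> psgn j i = - psgn i j"
  by (auto simp: psgn_def)

text \<open>Isolates the contribution of two indices \<open>a\<close>, \<open>b\<close>. Apart from the factor \<open>f a b\<close> it is symmetric in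
\<open>a\<close> and \<open>b\<close>, which makes the product alternating.\<close>

lemma pairprod_remove2_skew:
  assumes "finite I" "a \<in> I" "b \<in> I" "a \<noteq> b" "\<And>c d. f c d = - f d c"
  shows "pairprod I f = pairprod (I - {a,b}) f * (psgn a b * f a b) *
    (\<Prod>c\<in>I - {a,b}. psgn a c * psgn b c * (f a c * f b c))"
proof -
  have eq: "I - {a} - {b} = I - {a,b}" by auto
  have "(\<Prod>c\<in>I - {a}. psgn a c * f a c) = (psgn a b * f a b) * (\<Prod>c\<in>I - {a,b}. psgn a c * f a c)"
    using assms(1-4) prod.remove[of "I - {a}" b "\<lambda>c. psgn a c * f a c"] eq by simp
  moreover have "pairprod I f = pairprod (I - {a}) f * (\<Prod>c\<in>I - {a}. psgn a c * f a c)"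
    by (rule pairprod_remove_skew[OF assms(1,2)]) (rule assms(5))
  moreover have "pairprod (I - {a}) f = pairprod (I - {a,b}) f * (\<Prod>c\<in>I - {a,b}. psgn b c * f b c)"
    using pairprod_remove_skew[of "I - {a}" b f, OF _ _ assms(5)] assms(1-4) eq by simp
  ultimately show ?thesis by (simp add: prod.distrib mult_ac)
qed

lemma pairprod_skew_eq_0:
  assumes "finite I" "a \<in> I" "b \<in> I" "a \<noteq> b" "\<And>c d. f c d = - f d c" "f a b = (0::complex)"
  shows "pairprod I f = 0"
  using pairprod_remove2_skew[OF assms(1-5)] assms(6) by simp

lemma sum_PiE_insert:
  assumes "m \<notin> I"
  shows "(\<Sum>K\<in>PiE (insert m I) (\<lambda>_. B). f K) = (\<Sum>k\<in>B. \<Sum>K\<in>PiE I (\<lambda>_. B). f (K(m := k)))"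
proof -
  have "(\<Sum>K\<in>PiE (insert m I) (\<lambda>_. B). f K) =
      (\<Sum>(k, K)\<in>B \<times> PiE I (\<lambda>_. B). f (K(m := k)))"
    unfolding PiE_insert_eq
    by (subst sum.reindex) (use inj_combinator[OF assms] in \<open>auto simp: case_prod_unfold\<close>)
  then show ?thesis by (simp add: sum.cartesian_product)
qed

text \<open>The common shape of both multiple sums: a kernel \<open>\<kappa>\<close> for the pairs of summation indices and a
weight \<open>u\<close> for each single index.\<close>

definition altsum :: "(nat \<Rightarrow> nat \<Rightarrow> complex) \<Rightarrow> (nat \<Rightarrow> complex) \<Rightarrow> nat \<Rightarrow> nat set \<Rightarrow> (nat \<Rightarrow> complex) \<Rightarrow> complex"
  where "altsum \<kappa> u n I x = (\<Sum>K\<in>PiE I (\<lambda>_. {0..n}).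
      pairprod I (\<lambda>i j. \<kappa> (K i) (K j)) * (\<Prod>i\<in>I. u (K i) * x i ^ K i))"

lemma altsum_insert_max:
  assumes "finite I" "\<forall>i\<in>I. i < m"
  shows "altsum \<kappa> u n (insert m I) x = (\<Sum>k\<le>n. u k * x m ^ k *
     (\<Sum>K\<in>PiE I (\<lambda>_. {0..n}). pairprod I (\<lambda>i j. \<kappa> (K i) (K j)) * (\<Prod>i\<in>I. u (K i) * x i ^ K i) *
        (\<Prod>i\<in>I. \<kappa> (K i) k)))"
proof -
  have m: "m \<notin> I" using assms by auto
  have "altsum \<kappa> u n (insert m I) x = (\<Sum>k\<in>{0..n}. \<Sum>K\<in>PiE I (\<lambda>_. {0..n}).
      pairprod (insert m I) (\<lambda>i j. \<kappa> ((K(m := k)) i) ((K(m := k)) j)) *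
      (\<Prod>i\<in>insert m I. u ((K(m := k)) i) * x i ^ (K(m := k)) i))"
    unfolding altsum_def by (rule sum_PiE_insert[OF m])
  also have "\<dots> = (\<Sum>k\<in>{0..n}. \<Sum>K\<in>PiE I (\<lambda>_. {0..n}). u k * x m ^ k *
     (pairprod I (\<lambda>i j. \<kappa> (K i) (K j)) * (\<Prod>i\<in>I. u (K i) * x i ^ K i) *
        (\<Prod>i\<in>I. \<kappa> (K i) k)))"
  proof (intro sum.cong refl)
    fix k K
    have "pairprod (insert m I) (\<lambda>i j. \<kappa> ((K(m := k)) i) ((K(m := k)) j)) =
       pairprod I (\<lambda>i j. \<kappa> (K i) (K j)) * (\<Prod>i\<in>I. \<kappa> (K i) k)"
      unfolding pairprod_insert_max[OF assms]
      by (intro arg_cong2[where f="(*)"] pairprod_cong prod.cong) (use m in auto)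
    moreover have "(\<Prod>i\<in>I. u ((K(m := k)) i) * x i ^ (K(m := k)) i) = (\<Prod>i\<in>I. u (K i) * x i ^ K i)"
      by (intro prod.cong) (use m in auto)
    ultimately show "pairprod (insert m I) (\<lambda>i j. \<kappa> ((K(m := k)) i) ((K(m := k)) j)) *
      (\<Prod>i\<in>insert m I. u ((K(m := k)) i) * x i ^ (K(m := k)) i) = u k * x m ^ k *
     (pairprod I (\<lambda>i j. \<kappa> (K i) (K j)) * (\<Prod>i\<in>I. u (K i) * x i ^ K i) *
        (\<Prod>i\<in>I. \<kappa> (K i) k))"
      using assms m by (simp add: mult_ac)
  qed
  finally show ?thesis by (simp add: sum_distrib_left atLeast0AtMost)
qed

text \<open>Exchanging the values of the summation index at \<open>a\<close> and \<open>b\<close> is an involution that changes the sign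
of each summand.\<close>

lemma altsum_eq_0_if_eq:
  assumes "finite I" "a \<in> I" "b \<in> I" "a \<noteq> b" "x a = x b" "\<And>c d. \<kappa> c d = - \<kappa> d c"
  shows "altsum \<kappa> u n I x = 0"
proof -
  define sw where "sw = (\<lambda>K::nat\<Rightarrow>nat. K(a := K b, b := K a))"
  define T where "T = (\<lambda>K. pairprod I (\<lambda>i j. \<kappa> (K i) (K j)) * (\<Prod>i\<in>I. u (K i) * x i ^ K i))"
  have swsw: "sw (sw K) = K" for K using assms(4) by (auto simp: sw_def)
  have swI: "sw K \<in> PiE I (\<lambda>_. {0..n})" if "K \<in> PiE I (\<lambda>_. {0..n})" for K
    using that assms(2,3) by (auto simp: sw_def PiE_iff extensional_def)
  have skew: "T (sw K) = - T K" for K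
  proof -
    have pp: "pairprod I (\<lambda>i j. \<kappa> (K i) (K j)) = pairprod (I - {a,b}) (\<lambda>i j. \<kappa> (K i) (K j)) *
         (psgn a b * \<kappa> (K a) (K b)) *
         (\<Prod>c\<in>I - {a,b}. psgn a c * psgn b c * (\<kappa> (K a) (K c) * \<kappa> (K b) (K c)))" for K
      by (rule pairprod_remove2_skew[OF assms(1-4)]) (rule assms(6))
    have pr: "(\<Prod>i\<in>I. u (K i) * x i ^ K i) =
       (u (K a) * x a ^ K a) * (u (K b) * x b ^ K b) * (\<Prod>i\<in>I-{a,b}. u (K i) * x i ^ K i)" for K
    proof -
      have "I - {a} - {b} = I - {a,b}" by auto
      then show ?thesis using prod.remove[of I a "\<lambda>i. u (K i) * x i ^ K i"]
         prod.remove[of "I-{a}" b "\<lambda>i. u (K i) * x i ^ K i"] assms(1-4) by (simp add: mult_ac)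
    qed
    have v: "sw K a = K b" "sw K b = K a" using assms(4) by (auto simp: sw_def)
    have r: "sw K c = K c" if "c \<in> I - {a,b}" for c using that by (auto simp: sw_def)
    have 1: "pairprod (I - {a,b}) (\<lambda>i j. \<kappa> (sw K i) (sw K j)) = pairprod (I - {a,b}) (\<lambda>i j. \<kappa> (K i) (K j))"
      by (rule pairprod_cong) (auto simp: r)
    have 2: "(\<Prod>c\<in>I - {a,b}. psgn a c * psgn b c * (\<kappa> (K b) (sw K c) * \<kappa> (K a) (sw K c))) =
       (\<Prod>c\<in>I - {a,b}. psgn a c * psgn b c * (\<kappa> (K a) (K c) * \<kappa> (K b) (K c)))"
      by (intro prod.cong) (auto simp: r)
    have 3: "(\<Prod>i\<in>I-{a,b}. u (sw K i) * x i ^ sw K i) = (\<Prod>i\<in>I-{a,b}. u (K i) * x i ^ K i)"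
      by (intro prod.cong) (auto simp: r)
    have 4: "\<kappa> (K b) (K a) = - \<kappa> (K a) (K b)" by (rule assms)
    show ?thesis unfolding T_def pp[of K] pp[of "sw K"] pr[of K] pr[of "sw K"] v 1 2 3
      by (simp add: 4 assms(5))
  qed
  have "altsum \<kappa> u n I x = (\<Sum>K\<in>PiE I (\<lambda>_. {0..n}). T K)"
    unfolding altsum_def T_def ..
  also have "\<dots> = (\<Sum>K\<in>PiE I (\<lambda>_. {0..n}). T (sw K))"
    by (rule sum.reindex_bij_witness[of _ sw sw]) (auto simp: swsw swI)
  also have "\<dots> = - (\<Sum>K\<in>PiE I (\<lambda>_. {0..n}). T K)"
    by (simp add: skew sum_negf)
  finally show ?thesis by (simp add: altsum_def T_def)
qed

lemma pairprod_const:
  "finite I \<Longrightarrow> pairprod I (\<lambda>_ _. c) = c ^ (card I choose 2)"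
proof (induction rule: finite_linorder_max_induct)
  case (insert m I)
  have "m \<notin> I" using insert by auto
  then show ?case using insert pairprod_insert_max[of I m "\<lambda>_ _. c"]
    by (simp add: numeral_2_eq_2 power_add)
qed (simp add: pairprod_def numeral_2_eq_2)

lemma altsum_scale:
  assumes "finite I" "\<And>k. k \<le> n \<Longrightarrow> u k = c * u' k" "\<And>a b. \<kappa> a b = r * \<kappa>' a b"
  shows "altsum \<kappa> u n I x = r ^ (card I choose 2) * c ^ card I * altsum \<kappa>' u' n I x"
  unfolding altsum_def sum_distrib_left
proof (rule sum.cong[OF refl])
  fix K assume K: "K \<in> PiE I (\<lambda>_. {0..n})"
  have "pairprod I (\<lambda>i j. \<kappa> (K i) (K j)) = r ^ (card I choose 2) * pairprod I (\<lambda>i j. \<kappa>' (K i) (K j))"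
    unfolding assms(3) pairprod_mult pairprod_const[OF assms(1)] ..
  moreover have "(\<Prod>i\<in>I. u (K i) * x i ^ K i) = (\<Prod>i\<in>I. c * (u' (K i) * x i ^ K i))"
  proof (rule prod.cong[OF refl])
    fix i assume "i \<in> I"
    then have "K i \<le> n" using PiE_mem[OF K] by simp
    then show "u (K i) * x i ^ K i = c * (u' (K i) * x i ^ K i)" by (simp add: assms(2))
  qed
  ultimately show "pairprod I (\<lambda>i j. \<kappa> (K i) (K j)) * (\<Prod>i\<in>I. u (K i) * x i ^ K i) =
     r ^ (card I choose 2) * c ^ card I * (pairprod I (\<lambda>i j. \<kappa>' (K i) (K j)) * (\<Prod>i\<in>I. u' (K i) * x i ^ K i))"
    by (simp add: prod.distrib)
qed

lemma altsum_top:
  assumes "finite I" "u (Suc n) = 0"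
  shows "altsum \<kappa> u (Suc n) I x = altsum \<kappa> u n I x"
  unfolding altsum_def
proof (rule sum.mono_neutral_right)
  show "finite (PiE I (\<lambda>_. {0..Suc n}))" using assms by (intro finite_PiE) auto
  show "PiE I (\<lambda>_. {0..n}) \<subseteq> PiE I (\<lambda>_. {0..Suc n})" by (rule PiE_mono) auto
  show "\<forall>K\<in>PiE I (\<lambda>_. {0..Suc n}) - PiE I (\<lambda>_. {0..n}).
     pairprod I (\<lambda>i j. \<kappa> (K i) (K j)) * (\<Prod>i\<in>I. u (K i) * x i ^ K i) = 0"
  proof
    fix K assume K: "K \<in> PiE I (\<lambda>_. {0..Suc n}) - PiE I (\<lambda>_. {0..n})"
    then obtain i where "i \<in> I" "K i \<notin> {0..n}" by (auto simp: PiE_iff)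
    moreover have "K i \<in> {0..Suc n}" using K \<open>i \<in> I\<close> by auto
    ultimately have "K i = Suc n" by auto
    then have "(\<Prod>i\<in>I. u (K i) * x i ^ K i) = 0"
      using assms \<open>i \<in> I\<close> by (intro prod_zero) (auto intro!: bexI[of _ i])
    then show "pairprod I (\<lambda>i j. \<kappa> (K i) (K j)) * (\<Prod>i\<in>I. u (K i) * x i ^ K i) = 0" by simp
  qed
qed

text \<open>Summands in which some index is zero vanish. In the others every index is lowered by one, which
extracts one factor \<open>x i\<close> from each variable.\<close>

lemma altsum_shift:
  assumes "finite I" "u 0 = 0"
  shows "altsum \<kappa> u (Suc n) I x = (\<Prod>i\<in>I. x i) * altsum (\<lambda>a b. \<kappa> (Suc a) (Suc b)) (\<lambda>k. u (Suc k)) n I x"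
proof -
  define T where "T = (\<lambda>K. pairprod I (\<lambda>i j. \<kappa> (K i) (K j)) * (\<Prod>i\<in>I. u (K i) * x i ^ K i))"
  have "altsum \<kappa> u (Suc n) I x = (\<Sum>K\<in>PiE I (\<lambda>_. {0..Suc n}). T K)"
    by (simp add: altsum_def T_def)
  also have "\<dots> = (\<Sum>K\<in>PiE I (\<lambda>_. {1..Suc n}). T K)"
  proof (rule sum.mono_neutral_right)
    show "finite (PiE I (\<lambda>_. {0..Suc n}))" using assms by (intro finite_PiE) auto
    show "PiE I (\<lambda>_. {1..Suc n}) \<subseteq> PiE I (\<lambda>_. {0..Suc n})" by (rule PiE_mono) auto
    show "\<forall>K\<in>PiE I (\<lambda>_. {0..Suc n}) - PiE I (\<lambda>_. {1..Suc n}). T K = 0"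
    proof
      fix K assume K: "K \<in> PiE I (\<lambda>_. {0..Suc n}) - PiE I (\<lambda>_. {1..Suc n})"
      then obtain i where "i \<in> I" "K i \<notin> {1..Suc n}" by (auto simp: PiE_iff)
      moreover have "K i \<in> {0..Suc n}" using K \<open>i \<in> I\<close> by auto
      ultimately have "K i = 0" by auto
      then have "(\<Prod>i\<in>I. u (K i) * x i ^ K i) = 0"
        using assms \<open>i \<in> I\<close> by (intro prod_zero) (auto intro!: bexI[of _ i])
      then show "T K = 0" by (simp add: T_def)
    qed
  qed
  also have "\<dots> = (\<Sum>K\<in>PiE I (\<lambda>_. {0..n}). T (\<lambda>i. if i \<in> I then Suc (K i) else undefined))"
  proof (rule sum.reindex_bij_witness[of _ "\<lambda>K i. if i \<in> I then Suc (K i) else undefined"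
          "\<lambda>K i. if i \<in> I then K i - 1 else undefined"])
    fix K assume K: "K \<in> PiE I (\<lambda>_. {1..Suc n})"
    show e: "(\<lambda>i. if i \<in> I then Suc (if i \<in> I then K i - 1 else undefined) else undefined) = K"
    proof
      fix i
      show "(if i \<in> I then Suc (if i \<in> I then K i - 1 else undefined) else undefined) = K i"
        using PiE_mem[OF K, of i] PiE_arb[OF K, of i] by auto
    qed
    show "T (\<lambda>i. if i \<in> I then Suc (if i \<in> I then K i - 1 else undefined) else undefined) = T K"
      unfolding e ..
    show "(\<lambda>i. if i \<in> I then K i - 1 else undefined) \<in> PiE I (\<lambda>_. {0..n})"
      using PiE_mem[OF K] by (fastforce simp: PiE_iff extensional_def)
  next
    fix K assume K: "K \<in> PiE I (\<lambda>_. {0..n})"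
    show "(\<lambda>i. if i \<in> I then (if i \<in> I then Suc (K i) else undefined) - 1 else undefined) = K"
      using PiE_arb[OF K] by (auto simp: fun_eq_iff)
    show "(\<lambda>i. if i \<in> I then Suc (K i) else undefined) \<in> PiE I (\<lambda>_. {1..Suc n})"
      using PiE_mem[OF K] by (fastforce simp: PiE_iff extensional_def)
  qed
  also have "\<dots> = (\<Sum>K\<in>PiE I (\<lambda>_. {0..n}). (\<Prod>i\<in>I. x i) *
     (pairprod I (\<lambda>i j. \<kappa> (Suc (K i)) (Suc (K j))) * (\<Prod>i\<in>I. u (Suc (K i)) * x i ^ K i)))"
  proof (rule sum.cong[OF refl])
    fix K
    have "pairprod I (\<lambda>i j. \<kappa> (if i \<in> I then Suc (K i) else undefined) (if j \<in> I then Suc (K j) else undefined)) =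
       pairprod I (\<lambda>i j. \<kappa> (Suc (K i)) (Suc (K j)))" by (rule pairprod_cong) auto
    then show "T (\<lambda>i. if i \<in> I then Suc (K i) else undefined) = (\<Prod>i\<in>I. x i) *
     (pairprod I (\<lambda>i j. \<kappa> (Suc (K i)) (Suc (K j))) * (\<Prod>i\<in>I. u (Suc (K i)) * x i ^ K i))"
      by (simp add: T_def prod.distrib mult_ac)
  qed
  finally show ?thesis by (simp add: altsum_def sum_distrib_left)
qed

lemma altsum_insert_max_at_0:
  assumes "finite I" "\<forall>i\<in>I. i < m"
  shows "altsum \<kappa> u n (insert m I) (x(m := 0)) = u 0 * altsum \<kappa> (\<lambda>k. u k * \<kappa> k 0) n I x"
proof -
  have "altsum \<kappa> u n (insert m I) (x(m := 0)) = u 0 *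
     (\<Sum>K\<in>PiE I (\<lambda>_. {0..n}). pairprod I (\<lambda>i j. \<kappa> (K i) (K j)) * (\<Prod>i\<in>I. u (K i) * (x(m := 0)) i ^ K i) *
        (\<Prod>i\<in>I. \<kappa> (K i) 0))"
    unfolding altsum_insert_max[OF assms] by (simp add: sum.atMost_shift)
  also have "(\<Sum>K\<in>PiE I (\<lambda>_. {0..n}). pairprod I (\<lambda>i j. \<kappa> (K i) (K j)) * (\<Prod>i\<in>I. u (K i) * (x(m := 0)) i ^ K i) *
        (\<Prod>i\<in>I. \<kappa> (K i) 0)) = altsum \<kappa> (\<lambda>k. u k * \<kappa> k 0) n I x"
    unfolding altsum_def
  proof (rule sum.cong[OF refl])
    fix K
    have "(\<Prod>i\<in>I. u (K i) * (x(m := 0)) i ^ K i) = (\<Prod>i\<in>I. u (K i) * x i ^ K i)"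
      using assms(2) by (intro prod.cong) auto
    moreover have "(\<Prod>i\<in>I. u (K i) * x i ^ K i) * (\<Prod>i\<in>I. \<kappa> (K i) 0) = (\<Prod>i\<in>I. u (K i) * \<kappa> (K i) 0 * x i ^ K i)"
      by (simp add: prod.distrib mult_ac)
    ultimately show "pairprod I (\<lambda>i j. \<kappa> (K i) (K j)) * (\<Prod>i\<in>I. u (K i) * (x(m := 0)) i ^ K i) *
        (\<Prod>i\<in>I. \<kappa> (K i) 0) = pairprod I (\<lambda>i j. \<kappa> (K i) (K j)) * (\<Prod>i\<in>I. u (K i) * \<kappa> (K i) 0 * x i ^ K i)"
      by (simp only: mult.assoc)
  qed
  finally show ?thesis .
qed

section \<open>Functions that vanish at generic points\<close>

lemma continuous_fun_upd_apply: "continuous_on S (\<lambda>z::complex. (x(i := z)) j)"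
  by (cases "j = i") (auto intro: continuous_intros)

lemma continuous_pairprod:
  "finite I \<Longrightarrow> (\<And>i j. continuous_on S (\<lambda>z. f z i j)) \<Longrightarrow> continuous_on S (\<lambda>z::complex. pairprod I (f z))"
  unfolding pairprod_def by (intro continuous_intros)

lemma continuous_altsum:
  "continuous_on S (\<lambda>z::complex. altsum \<kappa> u n I (x(i := z)))"
  unfolding altsum_def by (intro continuous_intros continuous_fun_upd_apply)

lemma continuous_zero_cofinite:
  fixes f :: "complex \<Rightarrow> complex"
  assumes "continuous_on UNIV f" "finite B" "\<And>z. z \<notin> B \<Longrightarrow> f z = 0"
  shows "f w = 0"
proof -
  have "f \<midarrow>w\<rightarrow> f w" using assms(1) by (simp add: continuous_on_def)
  moreover have "\<forall>\<^sub>F z in at w. f z = 0"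
  proof -
    have "open (- (B - {w}))" using assms(2) by (intro open_Compl finite_imp_closed) auto
    then have "\<forall>\<^sub>F z in at w. z \<in> - (B - {w})"
      by (rule eventually_at_in_open') auto
    then show ?thesis using eventually_neq_at_within[of w w UNIV]
      by eventually_elim (use assms(3) in auto)
  qed
  then have "f \<midarrow>w\<rightarrow> 0" by (simp add: tendsto_eventually)
  ultimately show ?thesis using tendsto_unique[OF trivial_limit_at] by blast
qed

text \<open>For fixed \<open>x\<close> the function \<open>h x\<close> lies in a space spanned by as many polynomials as it has prescribed
zeros \<open>x i\<close>. For generic \<open>x\<close> each zero lowers the dimension of the space of candidates by one, so
that \<open>h x = 0\<close>; the exceptional values of each coordinate are finite in number and are reached
by continuity. The induction removes one coordinate \<open>x a = \<xi>\<close> and eliminates one basis element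
with its value at \<open>\<xi>\<close>. The points \<open>0\<close> are left out because the functions used below contain
\<open>1 / t\<close>.\<close>

lemma generic_interpolation_zero:
  fixes h :: "(nat \<Rightarrow> complex) \<Rightarrow> complex \<Rightarrow> complex" and b :: "'b \<Rightarrow> complex poly"
  assumes "finite I" "finite J" "card J = card I"
    and "\<And>x. (\<forall>i\<in>I. x i \<noteq> 0) \<Longrightarrow> \<exists>c. \<forall>t. t \<noteq> 0 \<longrightarrow> h x t = (\<Sum>j\<in>J. c j * poly (b j) t)"
    and "\<And>x i. (\<forall>i\<in>I. x i \<noteq> 0) \<Longrightarrow> i \<in> I \<Longrightarrow> h x (x i) = 0"
    and "\<And>x i t. i \<in> I \<Longrightarrow> t \<noteq> 0 \<Longrightarrow> continuous_on UNIV (\<lambda>z. h (x(i := z)) t)"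
    and "t \<noteq> 0"
  shows "h x t = 0"
  using assms
proof (induction I arbitrary: J b h x t rule: finite_induct)
  case empty
  then show ?case by auto
next
  case (insert a I)
  \<comment> \<open>If all basis elements are zero, the choice of the eliminated one does not matter.\<close>
  obtain j0 where j0: "j0 \<in> J" "(\<exists>j\<in>J. b j \<noteq> 0) \<Longrightarrow> b j0 \<noteq> 0"
    using insert.prems(2) insert.hyps by (metis card.empty card_insert_disjoint ex_in_conv nat.distinct(1))
  let ?J = "J - {j0}"
  have cJ: "card ?J = card I" using j0 insert.prems insert.hyps by simp
  define B where "B = insert 0 (if b j0 = 0 then {} else {z. poly (b j0) z = 0})"
  have finB: "finite B" by (auto simp: B_def poly_roots_finite)
  have good: "h (x(a := \<xi>)) t = 0" if \<xi>: "\<xi> \<notin> B" and t0: "t \<noteq> 0" for \<xi> x t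
  proof -
    define b' where "b' = (\<lambda>j. b j - smult (poly (b j) \<xi> / poly (b j0) \<xi>) (b j0))"
    have \<xi>0: "\<xi> \<noteq> 0" using \<xi> by (simp add: B_def)
    have upd: "\<forall>i\<in>insert a I. (x(a := \<xi>)) i \<noteq> 0" if "\<forall>i\<in>I. x i \<noteq> 0" for x
      using that \<xi> by (auto simp: B_def)
    show ?thesis
    proof (rule insert.IH[where h = "\<lambda>x. h (x(a := \<xi>))" and J = ?J and b = b'])
      show "finite ?J" using insert.prems by simp
      show "card ?J = card I" by (rule cJ)
      show "\<exists>c. \<forall>t. t \<noteq> 0 \<longrightarrow> h (x(a := \<xi>)) t = (\<Sum>j\<in>?J. c j * poly (b' j) t)" if nz: "\<forall>i\<in>I. x i \<noteq> 0" for x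
      proof -
        obtain c where c: "\<And>t. t \<noteq> 0 \<Longrightarrow> h (x(a := \<xi>)) t = (\<Sum>j\<in>J. c j * poly (b j) t)"
          using insert.prems(3)[OF upd[OF nz]] by blast
        have c': "h (x(a := \<xi>)) t = c j0 * poly (b j0) t + (\<Sum>j\<in>?J. c j * poly (b j) t)" if "t \<noteq> 0" for t
          using c[OF that] j0(1) insert.prems(1) by (simp add: sum.remove)
        have z: "h (x(a := \<xi>)) \<xi> = 0"
          using insert.prems(4)[OF upd[OF nz], of a] by (simp del: fun_upd_apply add: fun_upd_same)
        show ?thesis
        proof (cases "b j0 = 0")
          case True
          then show ?thesis using c' by (intro exI[of _ c]) (simp add: b'_def)
        next
          case False
          then have nzb: "poly (b j0) \<xi> \<noteq> 0" using \<xi> by (simp add: B_def)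
          have "c j0 = - (\<Sum>j\<in>?J. c j * poly (b j) \<xi>) / poly (b j0) \<xi>"
            using z nzb \<xi>0 unfolding c'[OF \<xi>0] by (simp add: field_simps eq_neg_iff_add_eq_0)
          then have "h (x(a := \<xi>)) t = (\<Sum>j\<in>?J. c j * poly (b' j) t)" if "t \<noteq> 0" for t
            unfolding c'[OF that] b'_def
            by (simp add: sum_subtractf right_diff_distrib sum_divide_distrib sum_distrib_left sum_distrib_right mult_ac)
          then show ?thesis by blast
        qed
      qed
      show "h (x(a := \<xi>)) (x i) = 0" if "\<forall>i\<in>I. x i \<noteq> 0" "i \<in> I" for x i
        proof -
        have "(x(a := \<xi>)) i = x i" using that insert.hyps by auto
        then show ?thesis using insert.prems(4)[OF upd[OF that(1)], of i] that by (simp del: fun_upd_apply)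
      qed
      show "continuous_on UNIV (\<lambda>z. h ((x(i := z))(a := \<xi>)) t)" if "i \<in> I" "t \<noteq> 0" for x i t
      proof -
        have "i \<noteq> a" using that insert.hyps by auto
        then have "(x(i := z))(a := \<xi>) = (x(a := \<xi>))(i := z)" for z by (auto simp: fun_upd_twist)
        then show ?thesis using insert.prems(5)[of i t "x(a := \<xi>)"] that by (simp del: fun_upd_apply)
      qed
      show "t \<noteq> 0" by (rule t0)
    qed
  qed
  have "h (x(a := x a)) t = 0"
    by (rule continuous_zero_cofinite[of "\<lambda>z. h (x(a := z)) t" B, OF insert.prems(5) finB good]) (use insert.prems(6) in simp_all)
  then show ?case by simp
qed

section \<open>Polynomials and finite sums\<close>

lemma roots_factor:
  fixes Y :: "complex poly"
  assumes "finite A" "\<And>a. a \<in> A \<Longrightarrow> poly Y a = 0"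
  shows "\<exists>P. Y = P * (\<Prod>a\<in>A. [:- a, 1:])"
  using assms
proof (induction A arbitrary: Y rule: finite_induct)
  case (insert a A)
  have "[:- a, 1:] dvd Y" using insert.prems by (simp add: poly_eq_0_iff_dvd)
  then obtain Z where Z: "Y = [:- a, 1:] * Z" by (auto elim: dvdE)
  have "poly Z b = 0" if "b \<in> A" for b
    using insert.prems[of b] that insert.hyps unfolding Z by auto
  then obtain P where "Z = P * (\<Prod>a\<in>A. [:- a, 1:])" using insert.IH by blast
  then show ?case using insert.hyps unfolding Z by (intro exI[of _ P]) (simp add: mult_ac)
qed (auto)

lemma poly_eq_sum_le:
  fixes p :: "complex poly"
  assumes "degree p \<le> n"
  shows "poly p x = (\<Sum>i\<le>n. coeff p i * x ^ i)"
  unfolding poly_altdef using assms by (intro sum.mono_neutral_left) (auto simp: coeff_eq_0)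

lemma degree_prod_linear:
  "finite A \<Longrightarrow> degree (\<Prod>a\<in>A. [:f a, 1::complex:]) = card A"
proof (induction rule: finite_induct)
  case (insert a A)
  have "(\<Prod>a\<in>A. [:f a, 1:]) \<noteq> 0" using insert.hyps by (simp add: prod_zero_iff)
  then show ?case using insert by (simp add: degree_mult_eq del: mult_pCons_left)
qed simp

lemma sum_symmetric_split:
  fixes f :: "nat \<Rightarrow> complex"
  shows "(\<Sum>i\<le>2 * M. f i) = f M + (\<Sum>j\<in>{1..M}. f (M + j) + f (M - j))"
proof -
  have "{..2 * M} = insert M ({..<M} \<union> {Suc M..2 * M})" by auto
  moreover have "sum f ({..<M} \<union> {Suc M..2 * M}) = sum f {..<M} + sum f {Suc M..2 * M}"
    by (rule sum.union_disjoint) auto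
  ultimately have "(\<Sum>i\<le>2 * M. f i) = f M + (sum f {..<M} + sum f {Suc M..2 * M})"
    by simp
  moreover have "sum f {..<M} = (\<Sum>j\<in>{1..M}. f (M - j))"
    by (rule sum.reindex_bij_witness[of _ "\<lambda>j. M - j" "\<lambda>j. M - j"]) auto
  moreover have "sum f {Suc M..2 * M} = (\<Sum>j\<in>{1..M}. f (M + j))"
    by (rule sum.reindex_bij_witness[of _ "\<lambda>j. M + j" "\<lambda>j. j - M"]) auto
  ultimately show ?thesis by (simp add: sum.distrib add_ac)
qed

lemma sum_atMost_reverse: "(\<Sum>k\<le>N. f k) = (\<Sum>k\<le>N. f (N - k :: nat))"
  by (rule sum.reindex_bij_witness[of _ "\<lambda>k. N - k" "\<lambda>k. N - k"]) auto

lemma poly_sum_monom: "poly (\<Sum>k\<le>N. monom (a k) k) t = (\<Sum>k\<le>N. a k * (t::complex) ^ k)"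
  by (simp add: poly_sum poly_monom)

section \<open>Well-poised weights\<close>

text \<open>The ratio of two neighbouring instances of the relation \<open>weight_link\<close> below; \<open>J\<close>, \<open>S\<close>, \<open>M\<close>
and \<open>N\<close> stand for \<open>q\<^sup>j\<close>, \<open>q\<^sup>s\<close>, \<open>q\<^sup>M\<close> and \<open>q\<^sup>n\<close>.\<close>

lemma link_ratio:
  fixes q J S M N :: complex
  assumes "q \<noteq> 0" "J \<noteq> 0" "S \<noteq> 0" "M \<noteq> 0" "N \<noteq> 0" "1 - q * J \<noteq> 0" "N + J \<noteq> 0"
    "1 - q * (J * S) \<noteq> 0" "N + J * S \<noteq> 0" "J * S - N * M \<noteq> 0"
  shows "((N - J) * (1 + q * J) / ((1 - q * J) * (N + J))) *
     ((q * (J * S) + M) * (q * N / M) / (q * (J * S) + q * N)) =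
    ((N * M - J * S) * (M + q * (J * S)) / (M * M * (1 - q * (J * S)) * (N + J * S))) *
    ((q * (J * S) - 1) * S / (q * (J * S) - S)) *
    ((q * (J * S) - N * (q * S)) * (M / S) / (q * (J * S) - N * (q * M))) *
    ((q * J + 1) * (q * N) / (q * J + q * N))"
proof -
  have f: "q * (J * S) + q * N = q * (N + J * S)" "q * (J * S) - S = - S * (1 - q * J)"
     "q * (J * S) - N * (q * S) = - q * S * (N - J)" "q * (J * S) - N * (q * M) = q * (J * S - N * M)"
     "q * J + q * N = q * (N + J)" "N * M - J * S = - (J * S - N * M)"
     "q * (J * S) - 1 = - (1 - q * (J * S))" "q * J + 1 = 1 + q * J" "q * (J * S) + M = M + q * (J * S)"
    by (simp_all add: algebra_simps)
  define a b c d e g h where "a = N - J" and "b = 1 + q * J" and "c = 1 - q * J" and "d = N + J"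
    and "e = M + q * (J * S)" and "g = N + J * S" and "h = J * S - N * M"
  define k where "k = 1 - q * (J * S)"
  show ?thesis unfolding f using assms
    unfolding a_def[symmetric] b_def[symmetric] c_def[symmetric] d_def[symmetric] e_def[symmetric]
       g_def[symmetric] h_def[symmetric] k_def[symmetric]
    by (simp add: field_simps)
qed

locale generic_base =
  fixes q :: complex
  assumes generic: "generic_q q"
begin

lemma q_nonzero [simp]: "q \<noteq> 0"
  using generic by (simp add: generic_q_def)

lemma q_power_eq_1_iff [simp]: "q ^ k = 1 \<longleftrightarrow> k = 0"
  using generic by (cases "k = 0") (auto simp: generic_q_def)

lemma q_power_eq_iff [simp]: "q ^ a = q ^ b \<longleftrightarrow> a = b"
proof (induction a b rule: linorder_wlog)
  case (le a b)
  have "q ^ a = q ^ b \<longleftrightarrow> q ^ a * 1 = q ^ a * q ^ (b - a)"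
    using le by (simp flip: power_add)
  also have "\<dots> \<longleftrightarrow> q ^ (b - a) = 1" by (subst mult_cancel_left) auto
  finally show ?case using le by auto
qed auto

lemma q_power_add_nonzero [simp]: "q ^ a + q ^ b \<noteq> 0"
proof
  assume "q ^ a + q ^ b = 0"
  then have eq: "q ^ a = - (q ^ b)" by (simp add: eq_neg_iff_add_eq_0)
  then have "(q ^ a)\<^sup>2 = (q ^ b)\<^sup>2" by simp
  then have "a = b" by (simp flip: power_mult)
  then show False using eq by simp
qed

lemma one_add_q_power_nonzero [simp]: "1 + q ^ a \<noteq> 0"
  using q_power_add_nonzero[of 0 a] by simp

lemma q_powi_diff: "q powi (int a - int b) = q ^ a / q ^ b"
  by (simp add: power_int_diff)

lemma one_minus_q_powi: "1 - q powi (int a - int b) = (q ^ b - q ^ a) / q ^ b"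
  by (simp add: q_powi_diff field_simps)

lemma one_plus_q_powi: "1 + q powi (int a - int b) = (q ^ b + q ^ a) / q ^ b"
  by (simp add: q_powi_diff field_simps)

lemma one_minus_q_mult_power_nonzero [simp]: "1 - q * q ^ a \<noteq> 0" "1 + q * q ^ a \<noteq> 0"
  using q_power_eq_1_iff[of "Suc a"] one_add_q_power_nonzero[of "Suc a"]
  by (auto simp del: q_power_eq_1_iff one_add_q_power_nonzero)

lemma q_mult_power_neq_1 [simp]: "q * q ^ a \<noteq> 1" "1 \<noteq> q * q ^ a"
  using one_minus_q_mult_power_nonzero(1)[of a] by auto

lemma qpoch_0 [simp]: "qpoch a q 0 = 1"
  by (simp add: qpoch_def)

lemma qpoch_Suc: "qpoch a q (Suc k) = qpoch a q k * (1 - a * q ^ k)"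
  by (simp add: qpoch_def)

lemma qpoch_Suc_shift: "qpoch a q (Suc k) = (1 - a) * qpoch (a * q) q k"
  unfolding qpoch_def by (subst prod.lessThan_Suc_shift) (simp add: mult_ac)

lemma qpoch_q_nonzero [simp]: "qpoch q q k \<noteq> 0"
  unfolding qpoch_def using one_minus_q_mult_power_nonzero(1) by (simp del: one_minus_q_mult_power_nonzero)

lemma qpoch_minus_powi_nonzero [simp]: "qpoch (- (q powi z)) q k \<noteq> 0"
proof -
  have "1 + q powi z * q ^ l \<noteq> 0" for l
  proof -
    obtain a b where z: "z = int a - int b"
      by (metis diff_0 diff_zero int_cases2 of_nat_0)
    have "1 + q powi z * q ^ l = (q ^ b + q ^ (a + l)) / q ^ b"
      unfolding z q_powi_diff by (simp add: field_simps power_add)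
    then show ?thesis by simp
  qed
  then show ?thesis by (simp add: qpoch_def)
qed

text \<open>The weight of the sum on the right-hand side for \<open>m = M + 1\<close>. With \<open>a = q\<^bsup>-(n+M)\<^esup>\<close> and
\<open>b = - q\<^bsup>1-M\<^esup>\<close> the lower parameter \<open>- q\<^bsup>-n\<^esup>\<close> is \<open>a q / b\<close>, so the weight is well-poised. For
\<open>M = 0\<close> it is the weight in the definition of \<open>P\<^sub>n\<close>.\<close>

definition wgt :: "nat \<Rightarrow> nat \<Rightarrow> nat \<Rightarrow> complex" where
  "wgt n M k = (qpoch (q powi (- int (n + M))) q k * qpoch (- (q powi (1 - int M))) q k) /
     (qpoch q q k * qpoch (- (q powi (- int n))) q k)"

lemma wgt_0 [simp]: "wgt n M 0 = 1"
  by (simp add: wgt_def)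

lemma wgt_Suc: "wgt n M (Suc k) = wgt n M k *
   ((q ^ (n + M) - q ^ k) * (q ^ M + q ^ Suc k) / (q ^ (2 * M) * (1 - q ^ Suc k) * (q ^ n + q ^ k)))"
proof -
  have e: "1 - q powi (- int (n + M)) * q ^ k = (q ^ (n + M) - q ^ k) / q ^ (n + M)"
    "1 + q powi (1 - int M) * q ^ k = (q ^ M + q ^ Suc k) / q ^ M"
    "1 + q powi (- int n) * q ^ k = (q ^ n + q ^ k) / q ^ n"
    by (simp_all add: power_int_minus power_int_diff field_simps power_add)
  have d: "(x / a) * (y / b) / (z * (w / c)) = c * (x * y) / (a * b * (z * w))" for x y z w a b c :: complex
    by simp
  have "wgt n M (Suc k) = wgt n M k *
    (((1 - q powi (- int (n + M)) * q ^ k) * (1 + q powi (1 - int M) * q ^ k)) /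
       ((1 - q ^ Suc k) * (1 + q powi (- int n) * q ^ k)))"
    unfolding wgt_def qpoch_Suc by (simp add: mult_ac)
  also have "((1 - q powi (- int (n + M)) * q ^ k) * (1 + q powi (1 - int M) * q ^ k)) /
       ((1 - q ^ Suc k) * (1 + q powi (- int n) * q ^ k)) =
      q ^ n * ((q ^ (n + M) - q ^ k) * (q ^ M + q ^ Suc k)) /
       (q ^ (n + M) * q ^ M * ((1 - q ^ Suc k) * (q ^ n + q ^ k)))"
    unfolding e d ..
  also have "q ^ (n + M) * q ^ M = q ^ n * q ^ (2 * M)" by (simp add: power_add mult_2)
  finally show ?thesis by (simp add: mult.assoc)
qed

text \<open>The rescaling of \<open>wgt\<close> that is invariant, up to a sign, under \<open>k \<mapsto> n + M - k\<close>.\<close>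

definition palin_wgt :: "nat \<Rightarrow> nat \<Rightarrow> nat \<Rightarrow> complex" where
  "palin_wgt n M k = q ^ (M * k) * wgt n M k"

lemma palin_wgt_Suc: "palin_wgt n M (Suc k) = palin_wgt n M k *
   ((q ^ (n + M) - q ^ k) * (q ^ M + q ^ Suc k) / (q ^ M * (1 - q ^ Suc k) * (q ^ n + q ^ k)))"
proof -
  have "q ^ (M * Suc k) = q ^ M * q ^ (M * k)" by (simp add: power_add)
  moreover have "q ^ (2 * M) = q ^ M * q ^ M" by (simp add: power_add mult_2)
  ultimately show ?thesis unfolding palin_wgt_def wgt_Suc by (simp add: mult_ac)
qed

text \<open>By induction on \<open>k\<close>: the ratio of consecutive weights at \<open>k\<close> is inverse to the ratio at
\<open>n + M - 1 - k\<close>.\<close>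

lemma palin_wgt_reflect:
  assumes "k \<le> n + M"
  shows "palin_wgt n M (n + M - k) = palin_wgt n M (n + M) * palin_wgt n M k"
  using assms
proof (induction k)
  case 0
  then show ?case by (simp add: palin_wgt_def)
next
  case (Suc k)
  define j where "j = n + M - Suc k"
  have j: "n + M - k = Suc j" "j + k + 1 = n + M" using Suc.prems by (auto simp: j_def)
  define A B C D where "A = q ^ k" and "B = q ^ j" and "C = q ^ M" and "D = q ^ n"
  define r where "r = (\<lambda>A. (D * C - A) * (C + q * A) / (C * (1 - q * A) * (D + A)))"
  have rel: "q * A * B = D * C"
    using j(2) unfolding A_def B_def C_def D_def
    by (metis Suc_eq_plus1 add.commute power_Suc power_add mult.assoc)
  have nz: "A \<noteq> 0" "B \<noteq> 0" "C \<noteq> 0" "D + A \<noteq> 0" "D + B \<noteq> 0" "1 - q * A \<noteq> 0" "1 - q * B \<noteq> 0"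
    unfolding A_def B_def C_def D_def by auto
  have "D = q * A * B / C" using rel nz by (simp add: field_simps)
  then have DA: "D + A = A * (C + q * B) / C" and DB: "D + B = B * (C + q * A) / C"
    and DCA: "D * C - A = A * (q * B - 1)" and DCB: "D * C - B = B * (q * A - 1)"
    using nz by (simp_all add: field_simps)
  have nz': "C + q * B \<noteq> 0" "C + q * A \<noteq> 0" using DA DB nz by auto
  have rr: "r A * r B = 1"
    unfolding r_def DA DB DCA DCB using nz nz' by (simp add: divide_simps) algebra
  have s1: "palin_wgt n M (Suc k) = palin_wgt n M k * r A" unfolding palin_wgt_Suc r_def A_def C_def D_def by (simp add: power_add)
  have s2: "palin_wgt n M (Suc j) = palin_wgt n M j * r B" unfolding palin_wgt_Suc r_def B_def C_def D_def by (simp add: power_add)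
  have "palin_wgt n M j = palin_wgt n M (Suc j) * r A" using s2 rr by (simp add: mult_ac)
  also have "palin_wgt n M (Suc j) = palin_wgt n M (n + M) * palin_wgt n M k" using Suc j by simp
  finally show ?case using s1 by (simp add: j_def mult_ac)
qed

section \<open>Comparison of the weights of both sides\<close>

lemma prod_q_shift:
  assumes "a \<le> b"
  shows "(\<Prod>l\<in>{a..<b}. q * z + c * q ^ l) * (q * z + c * q ^ b) =
    (q * z + c * q ^ a) * q ^ (b - a) * (\<Prod>l\<in>{a..<b}. z + c * q ^ l)"
  using assms
proof (induction b rule: dec_induct)
  case (step b)
  then show ?case by (simp add: Suc_diff_le algebra_simps)
qed simp

definition \<beta> :: "nat \<Rightarrow> complex" where "\<beta> n = qpoch (- q) q n / qpoch q q n"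

text \<open>The weight of \<open>P\<^sub>n\<close> with one factor of the prefactor of the sum absorbed into each variable.\<close>

definition \<alpha> :: "nat \<Rightarrow> nat \<Rightarrow> complex" where
  "\<alpha> n k = \<beta> n * wgt n 0 k"

lemma \<alpha>_Suc: "\<alpha> n (Suc k) = \<alpha> n k * ((q ^ n - q ^ k) * (1 + q ^ Suc k) / ((1 - q ^ Suc k) * (q ^ n + q ^ k)))"
  unfolding \<alpha>_def wgt_Suc by simp

text \<open>The three products that occur in the comparison of \<open>\<alpha> n (k - s)\<close> with \<open>wgt n M k\<close> as functions of
\<open>z = q\<^sup>k\<close>: \<open>fullprod\<close> clears the denominators of the kernel of \<open>P\<^sub>n\<close>, \<open>denprod\<close> collects the
candidate poles of the quotient, and \<open>numprod\<close> is its numerator.\<close>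

definition fullprod :: "nat \<Rightarrow> complex \<Rightarrow> complex" where
  "fullprod n z = (\<Prod>l\<in>{0..<Suc n}. z + q ^ l)"
definition denprod :: "nat \<Rightarrow> nat \<Rightarrow> complex \<Rightarrow> complex" where
  "denprod n M z = (\<Prod>l\<in>{M..<Suc n}. z + q ^ l)"
definition numprod :: "nat \<Rightarrow> nat \<Rightarrow> nat \<Rightarrow> complex \<Rightarrow> complex" where
  "numprod n M s z = (\<Prod>l\<in>{0..<s}. z - q ^ l) * (\<Prod>l\<in>{Suc s..<Suc M}. z - q ^ n * q ^ l)"

text \<open>The normalization that makes \<open>weight_link\<close> hold for \<open>j = s = 0\<close>.\<close>

definition \<gamma> :: "nat \<Rightarrow> nat \<Rightarrow> complex" where
  "\<gamma> n M = \<alpha> n 0 * denprod n M 1 / (numprod n M 0 1 * fullprod n 1)"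

lemma fullprod_shift: "fullprod n (q * z) * (q * z + q ^ Suc n) = (q * z + 1) * q ^ Suc n * fullprod n z"
  using prod_q_shift[of 0 "Suc n" z 1] by (simp add: fullprod_def)

lemma denprod_shift:
  assumes "M \<le> Suc n"
  shows "denprod n M (q * z) * (q * z + q ^ Suc n) = (q * z + q ^ M) * q ^ (Suc n - M) * denprod n M z"
  using prod_q_shift[OF assms, of z 1] by (simp add: denprod_def)

lemma numprod_shift:
  assumes "s \<le> M"
  shows "numprod n M s (q * z) * ((q * z - q ^ s) * (q * z - q ^ n * q ^ Suc M)) =
    (q * z - 1) * q ^ s * ((q * z - q ^ n * q ^ Suc s) * q ^ (M - s)) * numprod n M s z"
proof -
  have 1: "(\<Prod>l\<in>{0..<s}. q * z - q ^ l) * (q * z - q ^ s) =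
    (q * z - 1) * q ^ s * (\<Prod>l\<in>{0..<s}. z - q ^ l)"
    using prod_q_shift[of 0 s z "-1"] by simp
  have 2: "(\<Prod>l\<in>{Suc s..<Suc M}. q * z - q ^ n * q ^ l) * (q * z - q ^ n * q ^ Suc M) =
    (q * z - q ^ n * q ^ Suc s) * q ^ (M - s) * (\<Prod>l\<in>{Suc s..<Suc M}. z - q ^ n * q ^ l)"
    using prod_q_shift[of "Suc s" "Suc M" z "- (q ^ n)"] assms by simp
  have "numprod n M s (q * z) * ((q * z - q ^ s) * (q * z - q ^ n * q ^ Suc M)) =
     ((\<Prod>l\<in>{0..<s}. q * z - q ^ l) * (q * z - q ^ s)) *
     ((\<Prod>l\<in>{Suc s..<Suc M}. q * z - q ^ n * q ^ l) * (q * z - q ^ n * q ^ Suc M))"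
    by (simp only: numprod_def mult_ac)
  then show ?thesis unfolding 1 2 by (simp only: numprod_def mult_ac)
qed

lemma numprod_Suc:
  assumes "s < M"
  shows "numprod n M (Suc s) z * (z - q ^ n * q ^ Suc s) = numprod n M s z * (z - q ^ s)"
proof -
  have "{Suc s..<Suc M} = insert (Suc s) {Suc (Suc s)..<Suc M}" using assms by auto
  then show ?thesis by (simp add: numprod_def mult_ac)
qed

text \<open>Multiplication by the term of degree \<open>s\<close> of \<open>\<Prod>\<^sub>i (1 - x\<^sub>i t)\<close> moves the weight \<open>\<alpha> n j\<close> from degree \<open>j\<close> to
degree \<open>j + s\<close>. The relation expresses it through the weight \<open>wgt n M (j + s)\<close> and polynomials in
\<open>q\<^bsup>j+s\<^esup>\<close>; its dependence on \<open>s\<close> is what the cancellation of poles needs.\<close>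

definition weight_link :: "nat \<Rightarrow> nat \<Rightarrow> nat \<Rightarrow> nat \<Rightarrow> bool" where
  "weight_link n M j s \<longleftrightarrow> \<alpha> n j * denprod n M (q ^ (j + s)) =
     \<gamma> n M * q ^ (Suc n * s) * wgt n M (j + s) * numprod n M s (q ^ (j + s)) * fullprod n (q ^ j)"

lemma numprod_0_1_nonzero: "numprod n M 0 1 \<noteq> 0"
proof -
  have "1 - q ^ n * q ^ l \<noteq> 0" if "l \<ge> Suc 0" for l
    using q_power_eq_1_iff[of "n + l"] that by (simp add: power_add del: q_power_eq_1_iff)
  then show ?thesis by (auto simp: numprod_def)
qed

lemma fullprod_nonzero [simp]: "fullprod n (q ^ j) \<noteq> 0"
  by (simp add: fullprod_def)

lemma denprod_nonzero [simp]: "denprod n M (q ^ j) \<noteq> 0"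
  by (simp add: denprod_def)

lemma weight_link_0_0: "weight_link n M 0 0"
  using fullprod_nonzero[of n 0] numprod_0_1_nonzero by (simp add: weight_link_def \<gamma>_def)

lemma weight_link_Suc:
  assumes "weight_link n M j s" "j < n" "s \<le> M" "M \<le> n"
  shows "weight_link n M (Suc j) s"
proof -
  define J S C N where "J = q ^ j" and "S = q ^ s" and "C = q ^ M" and "N = q ^ n"
  have nz: "J \<noteq> 0" "S \<noteq> 0" "C \<noteq> 0" "N \<noteq> 0" "1 - q * J \<noteq> 0" "N + J \<noteq> 0"
    "1 - q * (J * S) \<noteq> 0" "N + J * S \<noteq> 0" "J * S - N * C \<noteq> 0"
    unfolding J_def S_def C_def N_def using assms
    by (auto simp flip: power_add power_Suc)
  have nz2: "q * (J * S) + q * N \<noteq> 0" "q * (J * S) - S \<noteq> 0" "q * (J * S) - N * (q * C) \<noteq> 0" "q * J + q * N \<noteq> 0"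
  proof -
    have "q * (J * S) + q * N = q * (N + J * S)" "q * (J * S) - S = - S * (1 - q * J)"
     "q * (J * S) - N * (q * C) = q * (J * S - N * C)" "q * J + q * N = q * (N + J)"
      by (simp_all add: algebra_simps)
    then show "q * (J * S) + q * N \<noteq> 0" "q * (J * S) - S \<noteq> 0" "q * (J * S) - N * (q * C) \<noteq> 0" "q * J + q * N \<noteq> 0"
      using nz by simp_all
  qed
  have p1: "q ^ (Suc n - M) = q * N / C" "q ^ (M - s) = C / S"
    unfolding J_def S_def C_def N_def using assms by (simp_all add: power_diff)
  have js: "q ^ (j + s) = J * S" "q ^ (Suc j + s) = q * (J * S)" "q ^ Suc j = q * J"
    by (simp_all add: J_def S_def power_add)
  have a: "\<alpha> n (Suc j) = \<alpha> n j * ((N - J) * (1 + q * J) / ((1 - q * J) * (N + J)))"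
    unfolding \<alpha>_Suc by (simp add: J_def N_def)
  have d: "denprod n M (q * (J * S)) = denprod n M (J * S) * ((q * (J * S) + C) * (q * N / C) / (q * (J * S) + q * N))"
    using denprod_shift[of M n "J * S"] assms(4) nz2 unfolding p1 by (simp add: eq_divide_eq mult_ac C_def N_def)
  have w: "wgt n M (Suc j + s) = wgt n M (j + s) * ((N * C - J * S) * (C + q * (J * S)) / (C * C * (1 - q * (J * S)) * (N + J * S)))"
  proof -
    have e: "q ^ (2 * M) = C * C" "q ^ Suc (j + s) = q * (J * S)" "q ^ (n + M) = N * C"
      by (simp_all add: J_def S_def C_def N_def power_add mult_2)
    show ?thesis using wgt_Suc[of n M "j + s"]
      unfolding e js(1) C_def[symmetric] N_def[symmetric] by (simp only: add_Suc)
  qed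
  have nu: "numprod n M s (q * (J * S)) = numprod n M s (J * S) *
     (((q * (J * S) - 1) * S / (q * (J * S) - S)) *
      ((q * (J * S) - N * (q * S)) * (C / S) / (q * (J * S) - N * (q * C))))"
    using numprod_shift[OF assms(3), of n "J * S"] nz2 unfolding p1
    by (simp add: eq_divide_eq mult_ac C_def N_def S_def)
  have fu: "fullprod n (q * J) = fullprod n J * ((q * J + 1) * (q * N) / (q * J + q * N))"
    using fullprod_shift[of n J] nz2 by (simp add: eq_divide_eq mult_ac N_def)
  note r = link_ratio[OF q_nonzero nz]
  have "\<alpha> n (Suc j) * denprod n M (q * (J * S)) = (\<alpha> n j * denprod n M (J * S)) *
     (((N - J) * (1 + q * J) / ((1 - q * J) * (N + J))) *
     ((q * (J * S) + C) * (q * N / C) / (q * (J * S) + q * N)))"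
    unfolding a d by (simp only: mult_ac)
  also have "\<alpha> n j * denprod n M (J * S) =
      \<gamma> n M * q ^ (Suc n * s) * wgt n M (j + s) * numprod n M s (J * S) * fullprod n J"
    using assms(1) unfolding weight_link_def js J_def[symmetric] .
  also note r
  finally show ?thesis unfolding weight_link_def js w nu fu by (simp only: mult_ac)
qed

lemma weight_link_down:
  assumes "weight_link n M (Suc j) s" "Suc j \<le> n" "s < M"
  shows "weight_link n M j (Suc s)"
proof -
  define J S N where "J = q ^ j" and "S = q ^ s" and "N = q ^ n"
  have nz: "J \<noteq> 0" "S \<noteq> 0" "N \<noteq> 0" "1 - q * J \<noteq> 0" "1 + q * J \<noteq> 0" "N + J \<noteq> 0" "N - J \<noteq> 0"
    "q * (J * S) - N * (q * S) \<noteq> 0"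
    unfolding J_def S_def N_def using assms
    by (auto simp flip: power_add power_Suc)
  have js: "q ^ (j + Suc s) = q * (J * S)" "q ^ (Suc j + s) = q * (J * S)" "q ^ Suc j = q * J"
     "j + Suc s = Suc j + s"
    by (simp_all add: J_def S_def power_add)
  have a: "\<alpha> n (Suc j) = \<alpha> n j * ((N - J) * (1 + q * J) / ((1 - q * J) * (N + J)))"
    unfolding \<alpha>_Suc by (simp add: J_def N_def)
  have fu: "fullprod n (q * J) * (q * J + q * N) = fullprod n J * ((q * J + 1) * (q * N))"
    using fullprod_shift[of n J] by (simp add: mult_ac N_def)
  have nu: "numprod n M s (q * (J * S)) * (q * (J * S) - S) = numprod n M (Suc s) (q * (J * S)) * (q * (J * S) - N * (q * S))"
    using numprod_Suc[OF assms(3), of n "q * (J * S)"] by (simp add: S_def N_def)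
  have exp: "q ^ (Suc n * Suc s) = q * N * q ^ (Suc n * s)" by (simp add: N_def power_add)
  define A F T X where "A = \<alpha> n j * denprod n M (q * (J * S))" and "F = fullprod n J"
    and "T = numprod n M (Suc s) (q * (J * S))" and "X = \<gamma> n M * q ^ (Suc n * s) * wgt n M (Suc j + s)"
  have e0: "\<alpha> n (Suc j) * denprod n M (q * (J * S)) = X * numprod n M s (q * (J * S)) * fullprod n (q * J)"
    using assms(1) unfolding weight_link_def js X_def .
  have f1: "fullprod n (q * J) = F * ((1 + q * J) * N) / (N + J)"
  proof -
    have "q * J + q * N = q * (N + J)" by (simp add: algebra_simps)
    then show ?thesis using fu nz unfolding F_def by (simp add: eq_divide_eq mult_ac add_ac)
  qed
  have f2: "numprod n M s (q * (J * S)) = T * (q * (N - J)) / (1 - q * J)"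
  proof -
    have "q * (J * S) - S = - S * (1 - q * J)" "q * (J * S) - N * (q * S) = - S * (q * (N - J))"
      by (simp_all add: algebra_simps)
    then show ?thesis using nu nz unfolding T_def by (simp add: eq_divide_eq mult_ac)
  qed
  have "A * ((N - J) * (1 + q * J) / ((1 - q * J) * (N + J))) =
     X * (q * N) * T * F * ((N - J) * (1 + q * J) / ((1 - q * J) * (N + J)))"
    using e0 unfolding a f1 f2 A_def by (simp add: mult_ac)
  then have "A = X * (q * N) * T * F" using nz by simp
  then show ?thesis unfolding weight_link_def js(1,2) exp js(4) A_def X_def T_def F_def J_def by (simp only: mult_ac)
qed

text \<open>The pairs \<open>(j, s)\<close> are reached from \<open>(0, 0)\<close> by the steps \<open>(0, s) \<rightarrow> (1, s) \<rightarrow> (0, s + 1)\<close> and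
\<open>(j, s) \<rightarrow> (j + 1, s)\<close>.\<close>

lemma weight_link_all:
  assumes "j \<le> n" "s \<le> M" "M \<le> n"
  shows "weight_link n M j s"
proof -
  have "weight_link n M 0 s" using assms(2)
  proof (induction s)
    case (Suc s)
    then have "weight_link n M 1 s" using weight_link_Suc[of n M 0 s] assms by simp
    then show ?case using weight_link_down[of n M 0 s] Suc.prems assms by simp
  qed (rule weight_link_0_0)
  then show ?thesis using assms(1)
  proof (induction j)
    case (Suc j)
    then show ?case using weight_link_Suc[of n M j s] assms by simp
  qed
qed

text \<open>For these \<open>k\<close> the polynomial \<open>P\<^sub>n\<close> has no term of degree \<open>k - s\<close> in the last variable, and the
numerator detects this.\<close>

lemma numprod_vanish:
  assumes "s \<le> M" "k \<le> n + M" "k < s \<or> n + s < k"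
  shows "numprod n M s (q ^ k) = 0"
proof (cases "k < s")
  case True
  then have "(\<Prod>l\<in>{0..<s}. q ^ k - q ^ l) = 0" by (intro prod_zero) auto
  then show ?thesis by (simp add: numprod_def)
next
  case False
  then have "k - n \<in> {Suc s..<Suc M}" "q ^ k - q ^ n * q ^ (k - n) = 0"
    using assms by (auto simp flip: power_add)
  then have "(\<Prod>l\<in>{Suc s..<Suc M}. q ^ k - q ^ n * q ^ l) = 0"
    by (intro prod_zero) (auto simp del: power_Suc)
  then show ?thesis by (simp add: numprod_def)
qed

text \<open>The derivative of \<open>fullprod n\<close> at \<open>- q\<^sup>j\<close>.\<close>

definition gapprod :: "nat \<Rightarrow> nat \<Rightarrow> complex" where
  "gapprod n j = (\<Prod>l\<in>{0..n} - {j}. q ^ l - q ^ j)"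

lemma gapprod_step:
  assumes "j < n"
  shows "q ^ n * gapprod n j * (1 - q ^ Suc j) = gapprod n (Suc j) * (q ^ Suc n - q ^ Suc j)"
proof -
  have "q ^ n * gapprod n j = (\<Prod>l\<in>{0..n} - {j}. q * (q ^ l - q ^ j))"
    using assms by (simp add: gapprod_def prod.distrib)
  also have "\<dots> = (\<Prod>l\<in>{1..Suc n} - {Suc j}. q ^ l - q ^ Suc j)"
    by (rule prod.reindex_bij_witness[of _ "\<lambda>l. l - 1" Suc]) (auto simp: algebra_simps)
  finally have "q ^ n * gapprod n j * (1 - q ^ Suc j) = (\<Prod>l\<in>insert 0 ({1..Suc n} - {Suc j}). q ^ l - q ^ Suc j)"
    by simp
  also have "insert 0 ({1..Suc n} - {Suc j}) = insert (Suc n) ({0..n} - {Suc j})"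
    using assms by auto
  finally show ?thesis by (simp add: gapprod_def)
qed

text \<open>The ratio of consecutive values of \<open>\<alpha>\<close> is \<open>\<rho>(q\<^sup>k)\<close> for a function with \<open>\<rho>(- z) = 1 / \<rho>(z)\<close>. Therefore
the value of the weight at \<open>z = - q\<^sup>j\<close> and its value at \<open>z = q\<^sup>j\<close> have a product that does not change
with \<open>j\<close>, and the residue at \<open>- q\<^sup>p\<close> has the same coefficient for every \<open>s\<close>.\<close>

lemma residue_const_step:
  assumes "s < M" "M \<le> p" "p \<le> n"
  shows "q ^ (Suc n * Suc s) * numprod n M (Suc s) (- (q ^ p)) * (q ^ (p - Suc s) * \<alpha> n (p - Suc s) * gapprod n (p - Suc s)) =
    q ^ (Suc n * s) * numprod n M s (- (q ^ p)) * (q ^ (p - s) * \<alpha> n (p - s) * gapprod n (p - s))"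
proof -
  define j where "j = p - Suc s"
  have j: "p - s = Suc j" "p = Suc j + s" "j < n" using assms by (auto simp: j_def)
  define J S N where "J = q ^ j" and "S = q ^ s" and "N = q ^ n"
  have nz: "J \<noteq> 0" "S \<noteq> 0" "N \<noteq> 0" "1 - q * J \<noteq> 0" "1 + q * J \<noteq> 0" "N + J \<noteq> 0" "N - J \<noteq> 0"
    unfolding J_def S_def N_def using j
    by (auto simp flip: power_add power_Suc)
  have js: "q ^ p = q * (J * S)" "q ^ Suc j = q * J" by (simp_all add: J_def S_def j(2) power_add)
  have a: "\<alpha> n (Suc j) = \<alpha> n j * ((N - J) * (1 + q * J) / ((1 - q * J) * (N + J)))"
    unfolding \<alpha>_Suc by (simp add: J_def N_def)
  have g: "gapprod n j = gapprod n (Suc j) * (q * (N - J)) / (N * (1 - q * J))"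
    using gapprod_step[OF j(3)] nz by (simp add: J_def N_def field_simps)
  have nu: "numprod n M s (- (q * (J * S))) = numprod n M (Suc s) (- (q * (J * S))) * (q * (N + J)) / (1 + q * J)"
  proof -
    have e: "- (q * (J * S)) - S = - S * (1 + q * J)" "- (q * (J * S)) - N * (q * S) = - S * (q * (N + J))"
      by (simp_all add: algebra_simps)
    have "numprod n M (Suc s) (- (q * (J * S))) * (- (q * (J * S)) - N * (q * S)) = numprod n M s (- (q * (J * S))) * (- (q * (J * S)) - S)"
      using numprod_Suc[OF assms(1), of n "- (q * (J * S))"] by (simp add: S_def N_def)
    then show ?thesis unfolding e using nz by (simp add: eq_divide_eq mult_ac)
  qed
  have exp: "q ^ (Suc n * Suc s) = q * N * q ^ (Suc n * s)" by (simp add: N_def power_add)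
  show ?thesis unfolding j(1) j_def[symmetric] js exp a g nu J_def[symmetric]
    using nz by (simp add: divide_simps)
qed

lemma residue_const:
  assumes "s \<le> M" "M \<le> p" "p \<le> n"
  shows "q ^ (Suc n * s) * numprod n M s (- (q ^ p)) * (q ^ (p - s) * \<alpha> n (p - s) * gapprod n (p - s)) =
    numprod n M 0 (- (q ^ p)) * (q ^ p * \<alpha> n p * gapprod n p)"
  using assms(1)
proof (induction s)
  case (Suc s)
  then show ?case using residue_const_step[of s M p n] assms by simp
qed simp

section \<open>Cancellation of poles\<close>

definition p_kernel :: "nat \<Rightarrow> nat \<Rightarrow> complex" where
  "p_kernel a b = (q ^ b - q ^ a) / (q ^ b + q ^ a)"

lemma p_kernel_skew: "p_kernel a b = - p_kernel b a"
  by (simp add: p_kernel_def add.commute divide_simps)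

definition psum :: "nat \<Rightarrow> nat set \<Rightarrow> (nat \<Rightarrow> complex) \<Rightarrow> complex" where
  "psum n I x = altsum p_kernel (\<alpha> n) n I x"

definition pterm :: "nat \<Rightarrow> nat set \<Rightarrow> (nat \<Rightarrow> complex) \<Rightarrow> (nat \<Rightarrow> nat) \<Rightarrow> complex" where
  "pterm n I x K = pairprod I (\<lambda>i j. p_kernel (K i) (K j)) * (\<Prod>i\<in>I. \<alpha> n (K i) * x i ^ K i)"

lemma psum_eq: "psum n I x = (\<Sum>K\<in>PiE I (\<lambda>_. {0..n}). pterm n I x K)"
  by (simp add: psum_def altsum_def pterm_def)

lemma pterm_noninj:
  assumes "finite I" "\<not> inj_on K I"
  shows "pterm n I x K = 0"
proof -
  obtain a b where ab: "a \<in> I" "b \<in> I" "a \<noteq> b" "K a = K b" using assms by (auto simp: inj_on_def)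
  have "pairprod I (\<lambda>i j. p_kernel (K i) (K j)) = 0"
    by (rule pairprod_skew_eq_0[OF assms(1) ab(1-3)]) (rule p_kernel_skew, simp add: ab p_kernel_def)
  then show ?thesis by (simp add: pterm_def)
qed

lemma pterm_cong: "(\<And>i. i \<in> I \<Longrightarrow> K i = K' i) \<Longrightarrow> pterm n I x K = pterm n I x K'"
  unfolding pterm_def by (intro arg_cong2[where f="(*)"] pairprod_cong prod.cong) auto

text \<open>In the sum over tuples the last index \<open>l\<close> enters through the rational function
\<open>\<Prod>\<^sub>i (z - q\<^bsup>K i\<^esup>) / (z + q\<^bsup>K i\<^esup>)\<close> of \<open>z = q\<^sup>l\<close>. For injective \<open>K\<close> this polynomial in \<open>z\<close> is that function
multiplied by \<open>fullprod n z\<close>; for other \<open>K\<close> the coefficient \<open>pterm\<close> is zero.\<close>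

definition cleared_pterm :: "nat \<Rightarrow> nat set \<Rightarrow> (nat \<Rightarrow> complex) \<Rightarrow> (nat \<Rightarrow> nat) \<Rightarrow> complex poly" where
  "cleared_pterm n I x K = smult (pterm n I x K) ((\<Prod>i\<in>I. [:- (q ^ K i), 1:]) * (\<Prod>j\<in>{0..n} - K ` I. [:q ^ j, 1:]))"

definition cleared_pslice :: "nat \<Rightarrow> nat set \<Rightarrow> (nat \<Rightarrow> complex) \<Rightarrow> complex poly" where
  "cleared_pslice n I x = (\<Sum>K\<in>PiE I (\<lambda>_. {0..n}). cleared_pterm n I x K)"

lemma fullprod_split:
  fixes n :: nat
  assumes "finite I" "inj_on K I" "K ` I \<subseteq> {0..n}"
  shows "(\<Prod>i\<in>I. g (K i)) * (\<Prod>j\<in>{0..n} - K ` I. g j) = (\<Prod>j\<in>{0..n}. g j :: complex)"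
proof -
  have "(\<Prod>i\<in>I. g (K i)) = (\<Prod>j\<in>K ` I. g j)" using assms(2) by (simp add: prod.reindex)
  then show ?thesis using prod.subset_diff[OF assms(3) finite_atLeastAtMost, of g] by (simp add: mult.commute)
qed

lemma degree_cleared_pslice:
  assumes "finite I"
  shows "degree (cleared_pslice n I x) \<le> Suc n"
  unfolding cleared_pslice_def
proof (intro degree_sum_le)
  show "finite (PiE I (\<lambda>_. {0..n}))" using assms by (intro finite_PiE) auto
  fix K assume K: "K \<in> PiE I (\<lambda>_. {0..n})"
  show "degree (cleared_pterm n I x K) \<le> Suc n"
  proof (cases "inj_on K I")
    case True
    have sub: "K ` I \<subseteq> {0..n}" using K by auto
    have c: "card (K ` I) = card I" "card (K ` I) \<le> Suc n"
      using True card_image card_mono[OF _ sub] by auto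
    have "degree (cleared_pterm n I x K) \<le> degree ((\<Prod>i\<in>I. [:- (q ^ K i), 1:]) * (\<Prod>j\<in>{0..n} - K ` I. [:q ^ j, 1:]))"
      unfolding cleared_pterm_def by (rule degree_smult_le)
    also have "\<dots> \<le> card I + card ({0..n} - K ` I)"
      using degree_mult_le degree_prod_linear[OF assms, of "\<lambda>i. - (q ^ K i)"]
        degree_prod_linear[of "{0..n} - K ` I" "\<lambda>i. q ^ i"] by (metis finite_Diff finite_atLeastAtMost)
    also have "\<dots> = Suc n" using c card_Diff_subset[of "K ` I" "{0..n}"] assms sub by simp
    finally show ?thesis .
  next
    case False
    then show ?thesis using pterm_noninj[OF assms False] by (simp add: cleared_pterm_def)
  qed
qed

lemma poly_cleared_pslice:
  assumes "finite I"
  shows "poly (cleared_pslice n I x) (q ^ l) = fullprod n (q ^ l) * (\<Sum>K\<in>PiE I (\<lambda>_. {0..n}).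
      pterm n I x K * (\<Prod>i\<in>I. p_kernel (K i) l))"
proof -
  have "poly (cleared_pterm n I x K) (q ^ l) = fullprod n (q ^ l) * (pterm n I x K * (\<Prod>i\<in>I. p_kernel (K i) l))"
    if K: "K \<in> PiE I (\<lambda>_. {0..n})" for K
  proof (cases "inj_on K I")
    case True
    have sub: "K ` I \<subseteq> {0..n}" using K by auto
    have f: "fullprod n (q ^ l) = (\<Prod>i\<in>I. q ^ l + q ^ K i) * (\<Prod>j\<in>{0..n} - K ` I. q ^ l + q ^ j)"
      using fullprod_split[OF assms True sub, of "\<lambda>j. q ^ l + q ^ j"]
      by (simp add: fullprod_def atLeastLessThanSuc_atLeastAtMost)
    have "(\<Prod>i\<in>I. q ^ l + q ^ K i) * (\<Prod>i\<in>I. p_kernel (K i) l) = (\<Prod>i\<in>I. q ^ l - q ^ K i)"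
      unfolding prod.distrib[symmetric] p_kernel_def by simp
    then show ?thesis unfolding f cleared_pterm_def by (simp add: poly_prod mult_ac add_ac)
  next
    case False
    then show ?thesis using pterm_noninj[OF assms False] by (simp add: cleared_pterm_def)
  qed
  then show ?thesis unfolding cleared_pslice_def by (simp add: poly_sum sum_distrib_left)
qed

text \<open>The sign with which the index at position \<open>i\<close> is moved to the first place.\<close>

definition pos_sgn :: "nat set \<Rightarrow> nat \<Rightarrow> complex" where
  "pos_sgn I i = (\<Prod>a\<in>I - {i}. psgn i a)"

lemma pterm_remove:
  assumes "finite I" "i \<in> I"
  shows "pterm n I x K = pos_sgn I i * (\<alpha> n (K i) * x i ^ K i) * pterm n (I - {i}) x K * (\<Prod>a\<in>I - {i}. p_kernel (K i) (K a))"
proof -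
  have "pairprod I (\<lambda>i j. p_kernel (K i) (K j)) = pairprod (I - {i}) (\<lambda>i j. p_kernel (K i) (K j)) * (\<Prod>a\<in>I - {i}. psgn i a * p_kernel (K i) (K a))"
    by (rule pairprod_remove_skew[OF assms]) (rule p_kernel_skew)
  then show ?thesis unfolding pterm_def pos_sgn_def
    using prod.remove[OF assms, of "\<lambda>i. \<alpha> n (K i) * x i ^ K i"] by (simp add: prod.distrib mult_ac)
qed

lemma pos_sgn_swap:
  assumes "finite I" "a \<in> I" "b \<in> I" "a \<noteq> b"
  shows "pos_sgn I a * pos_sgn (I - {a}) b = - (pos_sgn I b * pos_sgn (I - {b}) a)"
proof -
  have 1: "pos_sgn I a = psgn a b * pos_sgn (I - {b}) a" if "a \<in> I" "b \<in> I" "a \<noteq> b" for a b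
  proof -
    have "I - {a} - {b} = I - {b} - {a}" by auto
    then show ?thesis using prod.remove[of "I - {a}" b "psgn a"] that assms(1) by (simp add: pos_sgn_def)
  qed
  have e: "psgn b a = - psgn a b" using assms(4) by (rule psgn_skew)
  show ?thesis using 1[of a b] 1[of b a] assms by (simp add: e)
qed

text \<open>If exactly two indices of the tuple are equal to \<open>j\<close>, the terms that remove one or the other
cancel. In all other cases of a coincidence each reduced tuple still has one.\<close>

lemma sum_removed_noninj_eq_0:
  assumes "finite I" "\<not> inj_on K I"
  shows "(\<Sum>i\<in>I. if K i = j then pos_sgn I i * x i ^ j * pterm n (I - {i}) x K else 0) = 0"
proof -
  obtain a b where ab: "a \<in> I" "b \<in> I" "a \<noteq> b" "K a = K b" using assms by (auto simp: inj_on_def)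
  define f where "f = (\<lambda>i. if K i = j then pos_sgn I i * x i ^ j * pterm n (I - {i}) x K else 0)"
  have z: "f i = 0" if "i \<in> I - {a} - {b}" for i
  proof -
    have "\<not> inj_on K (I - {i})" using that ab by (auto simp: inj_on_def)
    then show ?thesis using pterm_noninj[of "I - {i}" K n x] assms(1) by (simp add: f_def)
  qed
  have "f a + f b = 0"
  proof (cases "K a = j")
    case True
    have eq: "I - {b} - {a} = I - {a} - {b}" by auto
    have 1: "pterm n (I - {a}) x K = pos_sgn (I - {a}) b * (\<alpha> n j * x b ^ j) * pterm n (I - {a} - {b}) x K * (\<Prod>c\<in>I - {a} - {b}. p_kernel j (K c))"
      using pterm_remove[of "I - {a}" b n x K] ab True assms by simp
    have 2: "pterm n (I - {b}) x K = pos_sgn (I - {b}) a * (\<alpha> n j * x a ^ j) * pterm n (I - {a} - {b}) x K * (\<Prod>c\<in>I - {a} - {b}. p_kernel j (K c))"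
      using pterm_remove[of "I - {b}" a n x K] ab True assms eq by simp
    have "f a + f b = (pos_sgn I a * pos_sgn (I - {a}) b + pos_sgn I b * pos_sgn (I - {b}) a) *
       (x a ^ j * x b ^ j * \<alpha> n j * pterm n (I - {a} - {b}) x K * (\<Prod>c\<in>I - {a} - {b}. p_kernel j (K c)))"
      using True ab(4) unfolding f_def 1 2 by (simp add: algebra_simps)
    then show ?thesis using pos_sgn_swap[OF assms(1) ab(1-3)] by simp
  next
    case False
    then show ?thesis using ab by (simp add: f_def)
  qed
  moreover have "sum f I = f a + (f b + sum f (I - {a} - {b}))"
    using assms(1) ab by (simp add: sum.remove[of I a] sum.remove[of "I - {a}" b])
  ultimately show ?thesis using z unfolding f_def[symmetric] by simp
qed

text \<open>At \<open>z = - q\<^sup>j\<close> only the tuples with an index equal to \<open>j\<close> contribute. The factors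
\<open>z - q\<^bsup>K a\<^esup>\<close> then cancel the kernel factors that involve this index, so that the value is given by
the summand with one variable removed. Non-injective tuples contribute zero to both sides,
which makes the right-hand side a sum over all tuples and hence expressible by \<open>psum\<close>.\<close>

lemma poly_cleared_pterm_neg:
  assumes "finite I" "K \<in> PiE I (\<lambda>_. {0..n})" "j \<le> n"
  shows "poly (cleared_pterm n I x K) (- (q ^ j)) = 2 * (-1) ^ card I * (q ^ j * \<alpha> n j * gapprod n j) *
     (\<Sum>i\<in>I. if K i = j then pos_sgn I i * x i ^ j * pterm n (I - {i}) x K else 0)"
proof (cases "inj_on K I")
  case False
  then show ?thesis using pterm_noninj[OF assms(1) False] by (simp add: cleared_pterm_def sum_removed_noninj_eq_0 assms(1))
next
  case inj: True
  show ?thesis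
  proof (cases "j \<in> K ` I")
    case False
    then have "(\<Prod>l\<in>{0..n} - K ` I. - (q ^ j) + q ^ l) = 0"
      using assms(3) by (intro prod_zero) auto
    moreover have "(\<Sum>i\<in>I. if K i = j then pos_sgn I i * x i ^ j * pterm n (I - {i}) x K else 0) = 0"
      using False by (intro sum.neutral) auto
    ultimately show ?thesis by (simp add: cleared_pterm_def poly_prod add_ac)
  next
    case True
    then obtain i where i: "i \<in> I" "K i = j" by auto
    have "K a = j \<longleftrightarrow> a = i" if "a \<in> I" for a using i that inj by (auto simp: inj_on_def)
    then have s: "(\<Sum>i\<in>I. if K i = j then pos_sgn I i * x i ^ j * pterm n (I - {i}) x K else 0) =
       (\<Sum>a\<in>I. if a = i then pos_sgn I i * x i ^ j * pterm n (I - {i}) x K else 0)"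
      by (intro sum.cong) auto
    have p: "(\<Prod>a\<in>I. - (q ^ j) - q ^ K a) = (- 2 * q ^ j) * (\<Prod>a\<in>I - {i}. - (q ^ j) - q ^ K a)"
      using i assms(1) by (simp add: prod.remove)
    have k: "(\<Prod>a\<in>I - {i}. - (q ^ j) - q ^ K a) * (\<Prod>a\<in>I - {i}. p_kernel j (K a)) = (\<Prod>a\<in>I - {i}. - (q ^ K a - q ^ j))"
      unfolding prod.distrib[symmetric]
    proof (rule prod.cong[OF refl])
      fix a
      have "- (q ^ j) - q ^ K a = - (q ^ K a + q ^ j)" by simp
      moreover have "- d * (u / d) = - u" if "d \<noteq> 0" for d u :: complex using that by simp
      ultimately show "(- (q ^ j) - q ^ K a) * p_kernel j (K a) = - (q ^ K a - q ^ j)"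
        unfolding p_kernel_def using q_power_add_nonzero[of "K a" j] by (simp only:)
    qed
    have sg: "(\<Prod>a\<in>I - {i}. - (q ^ K a - q ^ j)) = (-1) ^ (card I - 1) * (\<Prod>a\<in>I - {i}. q ^ K a - q ^ j)"
      unfolding prod_uminus using assms(1) i by simp
    have g: "(\<Prod>a\<in>I - {i}. q ^ K a - q ^ j) * (\<Prod>l\<in>{0..n} - K ` I. q ^ l - q ^ j) = gapprod n j"
    proof -
      have inj': "inj_on K (I - {i})" using inj by (auto intro: inj_on_subset)
      have "{0..n} - {j} - K ` (I - {i}) = {0..n} - K ` I" using i inj by (auto simp: inj_on_def)
      moreover have "K ` (I - {i}) \<subseteq> {0..n} - {j}" using i inj assms(2) by (auto simp: inj_on_def)
      moreover have "(\<Prod>a\<in>I - {i}. q ^ K a - q ^ j) = (\<Prod>l\<in>K ` (I - {i}). q ^ l - q ^ j)"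
        using inj' by (simp add: prod.reindex)
      ultimately show ?thesis unfolding gapprod_def
        using prod.subset_diff[of "K ` (I - {i})" "{0..n} - {j}" "\<lambda>l. q ^ l - q ^ j"] by (simp add: mult.commute)
    qed
    have "card I = Suc (card I - 1)" using i assms(1) by (cases "card I") auto
    then have c: "(-1::complex) ^ card I = - ((-1) ^ (card I - 1))"
      by (metis mult_minus1 power_Suc)
    have "poly (cleared_pterm n I x K) (- (q ^ j)) = pterm n I x K * ((\<Prod>a\<in>I. - (q ^ j) - q ^ K a) * (\<Prod>l\<in>{0..n} - K ` I. q ^ l - q ^ j))"
    proof -
      have "(\<Prod>i\<in>I. - (q ^ K i) - q ^ j) = (\<Prod>a\<in>I. - (q ^ j) - q ^ K a)"
        by (intro prod.cong) auto
      then show ?thesis by (simp add: cleared_pterm_def poly_prod)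
    qed
    also have "\<dots> = pos_sgn I i * (\<alpha> n j * x i ^ j) * pterm n (I - {i}) x K * (- 2 * q ^ j) *
       ((\<Prod>a\<in>I - {i}. - (q ^ j) - q ^ K a) * (\<Prod>a\<in>I - {i}. p_kernel j (K a))) * (\<Prod>l\<in>{0..n} - K ` I. q ^ l - q ^ j)"
      unfolding pterm_remove[OF assms(1) i(1), of n x K] i(2) p by (simp only: mult_ac)
    also have "\<dots> = pos_sgn I i * (\<alpha> n j * x i ^ j) * pterm n (I - {i}) x K * (- 2 * q ^ j) * (-1) ^ (card I - 1) *
       ((\<Prod>a\<in>I - {i}. q ^ K a - q ^ j) * (\<Prod>l\<in>{0..n} - K ` I. q ^ l - q ^ j))"
      unfolding k sg by (simp only: mult_ac)
    finally show ?thesis unfolding g s c using i assms(1) by (simp add: mult_ac)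
  qed
qed

lemma poly_cleared_pslice_neg:
  assumes "finite I" "j \<le> n"
  shows "poly (cleared_pslice n I x) (- (q ^ j)) = 2 * (-1) ^ card I * (q ^ j * \<alpha> n j * gapprod n j) *
     (\<Sum>i\<in>I. pos_sgn I i * x i ^ j * psum n (I - {i}) x)"
proof -
  let ?C = "2 * (-1) ^ card I * (q ^ j * \<alpha> n j * gapprod n j)"
  have inner: "(\<Sum>K\<in>PiE I (\<lambda>_. {0..n}). if K i = j then pos_sgn I i * x i ^ j * pterm n (I - {i}) x K else 0) =
     pos_sgn I i * x i ^ j * psum n (I - {i}) x" if i: "i \<in> I" for i
  proof -
    have I: "I = insert i (I - {i})" using i by auto
    have "(\<Sum>K\<in>PiE (insert i (I - {i})) (\<lambda>_. {0..n}). if K i = j then pos_sgn I i * x i ^ j * pterm n (I - {i}) x K else 0)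
       = (\<Sum>k\<in>{0..n}. \<Sum>K\<in>PiE (I - {i}) (\<lambda>_. {0..n}). if (K(i := k)) i = j then pos_sgn I i * x i ^ j * pterm n (I - {i}) x (K(i := k)) else 0)"
      by (rule sum_PiE_insert) auto
    also have "\<dots> = (\<Sum>k\<in>{0..n}. if k = j then pos_sgn I i * x i ^ j * psum n (I - {i}) x else 0)"
    proof (intro sum.cong refl)
      have up: "pterm n (I - {i}) x (K(i := k)) = pterm n (I - {i}) x K" for K k by (rule pterm_cong) auto
      fix k
      show "(\<Sum>K\<in>PiE (I - {i}) (\<lambda>_. {0..n}). if (K(i := k)) i = j then pos_sgn I i * x i ^ j * pterm n (I - {i}) x (K(i := k)) else 0) =
         (if k = j then pos_sgn I i * x i ^ j * psum n (I - {i}) x else 0)"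
        by (simp add: psum_eq sum_distrib_left up)
    qed
    finally show ?thesis using assms(2) I by simp
  qed
  have "poly (cleared_pslice n I x) (- (q ^ j)) = ?C * (\<Sum>K\<in>PiE I (\<lambda>_. {0..n}). \<Sum>i\<in>I. if K i = j then pos_sgn I i * x i ^ j * pterm n (I - {i}) x K else 0)"
    unfolding cleared_pslice_def by (simp add: poly_sum poly_cleared_pterm_neg[OF assms(1) _ assms(2)] sum_distrib_left)
  also have "(\<Sum>K\<in>PiE I (\<lambda>_. {0..n}). \<Sum>i\<in>I. if K i = j then pos_sgn I i * x i ^ j * pterm n (I - {i}) x K else 0) =
     (\<Sum>i\<in>I. pos_sgn I i * x i ^ j * psum n (I - {i}) x)"
    by (subst sum.swap) (simp add: inner)
  finally show ?thesis .
qed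

definition pslice :: "nat \<Rightarrow> nat set \<Rightarrow> (nat \<Rightarrow> complex) \<Rightarrow> nat \<Rightarrow> complex" where
  "pslice n I x k = (\<Sum>K\<in>PiE I (\<lambda>_. {0..n}). pterm n I x K * (\<Prod>i\<in>I. p_kernel (K i) k))"

lemma psum_insert_max:
  assumes "finite I" "\<forall>i\<in>I. i < m"
  shows "psum n (insert m I) x = (\<Sum>k\<le>n. \<alpha> n k * x m ^ k * pslice n I x k)"
  unfolding psum_def altsum_insert_max[OF assms] pslice_def pterm_def ..

text \<open>The coefficient of \<open>t\<^sup>k\<close> on the left, divided by \<open>wgt n M k\<close> and multiplied by \<open>denprod n M (q\<^sup>k)\<close>, is the
value at \<open>q\<^sup>k\<close> of a polynomial \<open>Y\<close> with degree at most \<open>M + n + 1\<close>. It is zero at each root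
\<open>- q\<^sup>p\<close> of \<open>denprod n M\<close>, so division by \<open>denprod n M\<close> leaves a polynomial of degree at most \<open>2M\<close>.\<close>

lemma psum_span:
  assumes I: "finite I" "card I = M" and "M \<le> n" and x: "\<And>i. i \<in> I \<Longrightarrow> x i \<noteq> 0"
  shows "\<exists>p. degree p \<le> 2 * M \<and> (\<forall>t. (\<Prod>i\<in>I. 1 - x i * t) * (\<Sum>k\<le>n. \<alpha> n k * t ^ k * pslice n I x k) =
     (\<Sum>k\<le>n + M. wgt n M k * poly p (q ^ k) * t ^ k))"
proof -
  define E where "E = (\<Prod>i\<in>I. [:1, - x i:])"
  define V where "V = (\<Sum>k\<le>n. monom (\<alpha> n k * pslice n I x k) k)"
  have polyE: "poly E t = (\<Prod>i\<in>I. 1 - x i * t)" for t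
    by (simp add: E_def poly_prod mult_ac)
  have polyV: "poly V t = (\<Sum>k\<le>n. \<alpha> n k * t ^ k * pslice n I x k)" for t
    by (simp add: V_def poly_sum poly_monom mult_ac)
  have coeffV: "coeff V k = (if k \<le> n then \<alpha> n k * pslice n I x k else 0)" for k
    by (simp add: V_def coeff_sum)
  have degE: "degree E \<le> M"
  proof -
    have "degree E \<le> sum (degree \<circ> (\<lambda>i. [:1, - x i:])) I"
      unfolding E_def by (rule degree_prod_sum_le[OF I(1)])
    also have "\<dots> \<le> (\<Sum>i\<in>I. 1)" by (intro sum_mono) simp
    finally show ?thesis using I by simp
  qed
  have degV: "degree V \<le> n"
    unfolding V_def by (intro degree_sum_le) (auto intro: order.trans[OF degree_monom_le])
  have degEV: "degree (E * V) \<le> n + M"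
    using degree_mult_le[of E V] degE degV by simp
  \<comment> \<open>The reason for the cancellation: \<open>1 / x i\<close> is a root of \<open>E\<close>.\<close>
  have E0: "(\<Sum>s\<le>M. coeff E s * x i ^ (p - s)) = 0" if "i \<in> I" "M \<le> p" for i p
  proof -
    have "poly E (inverse (x i)) = 0"
      unfolding polyE using that x[OF that(1)] I(1) by (intro prod_zero) (auto intro!: bexI[of _ i])
    then have "(\<Sum>s\<le>M. coeff E s * inverse (x i) ^ s) = 0"
      using poly_eq_sum_le[OF degE] by simp
    then have "x i ^ p * (\<Sum>s\<le>M. coeff E s * inverse (x i) ^ s) = 0" by simp
    moreover have "x i ^ p * (coeff E s * inverse (x i) ^ s) = coeff E s * x i ^ (p - s)" if "s \<le> M" for s
      using x[OF \<open>i \<in> I\<close>] that \<open>M \<le> p\<close> by (simp add: power_diff power_inverse field_simps)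
    ultimately show ?thesis by (simp add: sum_distrib_left)
  qed
  define Np where "Np = (\<lambda>s. (\<Prod>l\<in>{0..<s}. [:- (q ^ l), 1:]) * (\<Prod>l\<in>{Suc s..<Suc M}. [:- (q ^ n * q ^ l), 1:]))"
  have polyNp: "poly (Np s) z = numprod n M s z" for s z
    by (simp add: Np_def numprod_def poly_prod del: prod.op_ivl_Suc)
  have degNp: "degree (Np s) \<le> M" if "s \<le> M" for s
  proof -
    have "degree (Np s) \<le> s + (M - s)" unfolding Np_def
      using degree_mult_le[of "\<Prod>l\<in>{0..<s}. [:- (q ^ l), 1:]" "\<Prod>l\<in>{Suc s..<Suc M}. [:- (q ^ n * q ^ l), 1:]"]
        degree_prod_linear[of "{0..<s}" "\<lambda>l. - (q ^ l)"]
        degree_prod_linear[of "{Suc s..<Suc M}" "\<lambda>l. - (q ^ n * q ^ l)"] by simp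
    then show ?thesis using that by simp
  qed
  define Y where "Y = (\<Sum>s\<le>M. smult (coeff E s * q ^ (Suc n * s)) (Np s * pcompose (cleared_pslice n I x) [:0, inverse (q ^ s):]))"
  have polyY: "poly Y z = (\<Sum>s\<le>M. coeff E s * q ^ (Suc n * s) * (numprod n M s z * poly (cleared_pslice n I x) (z / q ^ s)))" for z
    by (simp add: Y_def poly_sum poly_pcompose polyNp field_simps)
  have degY: "degree Y \<le> M + Suc n"
    unfolding Y_def
  proof (intro degree_sum_le order.trans[OF degree_smult_le] order.trans[OF degree_mult_le] add_mono)
    fix s assume "s \<in> {..M}"
    then show "degree (Np s) \<le> M" by (simp add: degNp)
    have "degree (pcompose (cleared_pslice n I x) [:0, inverse (q ^ s):]) \<le> degree (cleared_pslice n I x) * 1"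
      by (rule order.trans[OF degree_pcompose_le]) (intro mult_left_mono, auto)
    then show "degree (pcompose (cleared_pslice n I x) [:0, inverse (q ^ s):]) \<le> Suc n"
      using degree_cleared_pslice[OF I(1), of n x] by simp
  qed simp
  have rootY: "poly Y (- (q ^ p)) = 0" if p: "M \<le> p" "p \<le> n" for p
  proof -
    define c where "c = numprod n M 0 (- (q ^ p)) * (q ^ p * \<alpha> n p * gapprod n p) * (2 * (-1) ^ M)"
    have "coeff E s * q ^ (Suc n * s) * (numprod n M s (- (q ^ p)) * poly (cleared_pslice n I x) (- (q ^ p) / q ^ s)) =
       c * (\<Sum>i\<in>I. pos_sgn I i * psum n (I - {i}) x * (coeff E s * x i ^ (p - s)))" if s: "s \<le> M" for s
    proof -
      have "- (q ^ p) / q ^ s = - (q ^ (p - s))" using s p by (simp add: power_diff)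
      then have "poly (cleared_pslice n I x) (- (q ^ p) / q ^ s) = 2 * (-1) ^ M * (q ^ (p - s) * \<alpha> n (p - s) * gapprod n (p - s)) *
         (\<Sum>i\<in>I. pos_sgn I i * x i ^ (p - s) * psum n (I - {i}) x)"
        using poly_cleared_pslice_neg[OF I(1), of "p - s" n x] p I(2) by simp
      then have "coeff E s * q ^ (Suc n * s) * (numprod n M s (- (q ^ p)) * poly (cleared_pslice n I x) (- (q ^ p) / q ^ s)) =
        coeff E s * (q ^ (Suc n * s) * numprod n M s (- (q ^ p)) * (q ^ (p - s) * \<alpha> n (p - s) * gapprod n (p - s))) * (2 * (-1) ^ M) *
         (\<Sum>i\<in>I. pos_sgn I i * x i ^ (p - s) * psum n (I - {i}) x)"
        by (simp only: mult_ac)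
      also have "\<dots> = c * (coeff E s * (\<Sum>i\<in>I. pos_sgn I i * x i ^ (p - s) * psum n (I - {i}) x))"
        unfolding residue_const[OF s p] c_def by (simp only: mult_ac)
      finally show ?thesis by (simp add: sum_distrib_left mult_ac)
    qed
    then have "poly Y (- (q ^ p)) = (\<Sum>s\<le>M. c * (\<Sum>i\<in>I. pos_sgn I i * psum n (I - {i}) x * (coeff E s * x i ^ (p - s))))"
      unfolding polyY by simp
    also have "\<dots> = c * (\<Sum>i\<in>I. pos_sgn I i * psum n (I - {i}) x * (\<Sum>s\<le>M. coeff E s * x i ^ (p - s)))"
      unfolding sum_distrib_left by (subst sum.swap) (rule refl)
    finally show ?thesis using E0 p by simp
  qed
  define A where "A = (\<lambda>p. - (q ^ p)) ` {M..<Suc n}"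
  have inj: "inj_on (\<lambda>p. - (q ^ p)) {M..<Suc n}" by (auto simp: inj_on_def)
  have "\<exists>P. Y = P * (\<Prod>a\<in>A. [:- a, 1:])"
    by (rule roots_factor) (auto simp: A_def rootY)
  then obtain P where P: "Y = P * (\<Prod>a\<in>A. [:- a, 1:])" by blast
  have polyA: "poly (\<Prod>a\<in>A. [:- a, 1:]) z = denprod n M z" for z
    unfolding A_def denprod_def by (subst prod.reindex[OF inj]) (simp add: poly_prod add_ac del: prod.op_ivl_Suc)
  have degP: "degree P \<le> 2 * M"
  proof (cases "P = 0")
    case False
    have "(\<Prod>a\<in>A. [:- a, 1:]) \<noteq> 0" by (simp add: A_def prod_zero_iff)
    then have "degree Y = degree P + degree (\<Prod>a\<in>A. [:- a, 1:])"
      unfolding P using False by (simp add: degree_mult_eq)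
    moreover have "degree (\<Prod>a\<in>A. [:- a, 1:]) = Suc n - M"
      using degree_prod_linear[of A uminus] card_image[OF inj] by (simp add: A_def)
    ultimately show ?thesis using degY \<open>M \<le> n\<close> by simp
  qed simp
  have coeffs: "coeff (E * V) k = wgt n M k * poly (smult (\<gamma> n M) P) (q ^ k)" if k: "k \<le> n + M" for k
  proof -
    \<comment> \<open>Outside the range where \<open>coeff V (k - s)\<close> is nonzero, \<open>numprod\<close> vanishes at \<open>q\<^sup>k\<close>.\<close>
    have summand: "(if s \<le> k then coeff E s * coeff V (k - s) else 0) * denprod n M (q ^ k) =
       \<gamma> n M * wgt n M k * (coeff E s * q ^ (Suc n * s) * (numprod n M s (q ^ k) * poly (cleared_pslice n I x) (q ^ k / q ^ s)))"
      if s: "s \<le> M" for s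
    proof (cases "s \<le> k \<and> k - s \<le> n")
      case True
      have e: "q ^ k / q ^ s = q ^ (k - s)" using True by (simp add: power_diff)
      have l: "\<alpha> n (k - s) * denprod n M (q ^ k) =
     \<gamma> n M * q ^ (Suc n * s) * wgt n M k * numprod n M s (q ^ k) * fullprod n (q ^ (k - s))"
        using weight_link_all[of "k - s" n s M] True s \<open>M \<le> n\<close> by (simp add: weight_link_def)
      have "(if s \<le> k then coeff E s * coeff V (k - s) else 0) * denprod n M (q ^ k) =
          coeff E s * (\<alpha> n (k - s) * denprod n M (q ^ k)) * pslice n I x (k - s)"
        using True by (simp add: coeffV)
      then show ?thesis unfolding l e poly_cleared_pslice[OF I(1)] pslice_def[symmetric] by (simp only: mult_ac)
    next
      case False
      then have "numprod n M s (q ^ k) = 0" using s k by (intro numprod_vanish) auto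
      then show ?thesis using False by (auto simp: coeffV)
    qed
    have "coeff (E * V) k = (\<Sum>s\<le>k. coeff E s * coeff V (k - s))" by (rule coeff_mult)
    also have "\<dots> = (\<Sum>s\<in>{..k} \<inter> {..M}. coeff E s * coeff V (k - s))"
      using degE by (intro sum.mono_neutral_right) (auto simp: coeff_eq_0)
    also have "\<dots> = (\<Sum>s\<le>M. if s \<le> k then coeff E s * coeff V (k - s) else 0)"
      by (intro sum.mono_neutral_cong_left) auto
    finally have "coeff (E * V) k * denprod n M (q ^ k) = \<gamma> n M * wgt n M k * poly Y (q ^ k)"
      by (simp add: sum_distrib_right sum_distrib_left polyY summand)
    also have "\<dots> = (wgt n M k * poly (smult (\<gamma> n M) P) (q ^ k)) * denprod n M (q ^ k)"
      unfolding P poly_mult polyA by simp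
    finally show ?thesis by simp
  qed
  show ?thesis
  proof (intro exI[of _ "smult (\<gamma> n M) P"] conjI allI)
    show "degree (smult (\<gamma> n M) P) \<le> 2 * M" using degP degree_smult_le order.trans by blast
    fix t
    have "(\<Prod>i\<in>I. 1 - x i * t) * (\<Sum>k\<le>n. \<alpha> n k * t ^ k * pslice n I x k) = poly (E * V) t"
      by (simp add: polyE polyV)
    also have "\<dots> = (\<Sum>k\<le>n + M. coeff (E * V) k * t ^ k)" by (rule poly_eq_sum_le[OF degEV])
    also have "\<dots> = (\<Sum>k\<le>n + M. wgt n M k * poly (smult (\<gamma> n M) P) (q ^ k) * t ^ k)"
      by (intro sum.cong refl) (simp only: coeffs atMost_iff)
    finally show "(\<Prod>i\<in>I. 1 - x i * t) * (\<Sum>k\<le>n. \<alpha> n k * t ^ k * pslice n I x k) =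
       (\<Sum>k\<le>n + M. wgt n M k * poly (smult (\<gamma> n M) P) (q ^ k) * t ^ k)" .
  qed
qed

section \<open>Reflection and uniqueness in the last variable\<close>

text \<open>The polynomial in \<open>q\<^sup>k\<close> that accompanies \<open>wgt\<close> becomes a Laurent polynomial with exponents between
\<open>- M\<close> and \<open>M\<close> when it accompanies \<open>palin_wgt\<close>. The function is evaluated at \<open>q\<^sup>k\<close>.\<close>

definition laurent :: "nat \<Rightarrow> complex poly \<Rightarrow> nat \<Rightarrow> complex" where
  "laurent M p k = poly p (q ^ k) / q ^ (M * k)"

lemma wgt_poly_laurent: "wgt n M k * poly p (q ^ k) = palin_wgt n M k * laurent M p k"
  by (simp add: laurent_def palin_wgt_def)

lemma laurent_expand:
  assumes "degree p \<le> 2 * M"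
  shows "laurent M p k = coeff p M +
    (\<Sum>j\<in>{1..M}. coeff p (M + j) * q ^ (j * k) + coeff p (M - j) / q ^ (j * k))"
proof -
  have "poly p (q ^ k) = (\<Sum>i\<le>2 * M. coeff p i * q ^ (k * i))"
    unfolding poly_eq_sum_le[OF assms] by (simp add: power_mult)
  then have "laurent M p k = (\<Sum>i\<le>2 * M. coeff p i * q ^ (k * i) / q ^ (M * k))"
    by (simp add: laurent_def sum_divide_distrib)
  also have "\<dots> = coeff p M + (\<Sum>j\<in>{1..M}. coeff p (M + j) * q ^ (j * k) + coeff p (M - j) / q ^ (j * k))"
    unfolding sum_symmetric_split
  proof (intro arg_cong2[where f="(+)"] sum.cong refl)
    show "coeff p M * q ^ (k * M) / q ^ (M * k) = coeff p M" by (simp add: mult.commute)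
    fix j assume j: "j \<in> {1..M}"
    show "coeff p (M + j) * q ^ (k * (M + j)) / q ^ (M * k) = coeff p (M + j) * q ^ (j * k)"
      by (simp add: algebra_simps power_add)
    have "q ^ (M * k) = q ^ (k * (M - j)) * q ^ (j * k)"
      using j by (simp flip: power_add add: algebra_simps)
    then show "coeff p (M - j) * q ^ (k * (M - j)) / q ^ (M * k) = coeff p (M - j) / q ^ (j * k)"
      by simp
  qed
  finally show ?thesis .
qed

lemma laurent_reflect_expand:
  assumes "degree p \<le> 2 * M" "k \<le> N"
  shows "laurent M p (N - k) = coeff p M +
    (\<Sum>j\<in>{1..M}. coeff p (M + j) * q ^ (j * (N - k)) + coeff p (M - j) / q ^ (j * N) * q ^ (j * k))"
    and "laurent M p k = coeff p M +
    (\<Sum>j\<in>{1..M}. coeff p (M + j) * q ^ (j * k) + coeff p (M - j) / q ^ (j * N) * q ^ (j * (N - k)))"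
proof -
  have e: "q ^ (j * N) = q ^ (j * (N - k)) * q ^ (j * k)" for j
    using assms(2) by (simp flip: power_add add: algebra_simps)
  show "laurent M p (N - k) = coeff p M +
    (\<Sum>j\<in>{1..M}. coeff p (M + j) * q ^ (j * (N - k)) + coeff p (M - j) / q ^ (j * N) * q ^ (j * k))"
    unfolding laurent_expand[OF assms(1)] e by simp
  show "laurent M p k = coeff p M +
    (\<Sum>j\<in>{1..M}. coeff p (M + j) * q ^ (j * k) + coeff p (M - j) / q ^ (j * N) * q ^ (j * (N - k)))"
    unfolding laurent_expand[OF assms(1), of k] e by simp
qed

text \<open>The antisymmetric and, below, the symmetric combinations of a monomial and its image under
\<open>k \<mapsto> N - k\<close> come in pairs of exponents \<open>j\<close> and \<open>- j\<close>; only \<open>M\<close> of them are needed.\<close>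

lemma laurent_antisym:
  assumes "degree p \<le> 2 * M" "k \<le> N"
  shows "laurent M p k - laurent M p (N - k) =
    (\<Sum>j\<in>{1..M}. (coeff p (M + j) - coeff p (M - j) / q ^ (j * N)) * (q ^ (j * k) - q ^ (j * (N - k))))"
  unfolding laurent_reflect_expand[OF assms]
  by (simp add: sum_subtractf[symmetric] algebra_simps)

lemma laurent_sym:
  assumes "degree p \<le> 2 * M" "k \<le> N"
  shows "laurent M p k + laurent M p (N - k) = 2 * coeff p M +
    (\<Sum>j\<in>{1..M}. (coeff p (M + j) + coeff p (M - j) / q ^ (j * N)) * (q ^ (j * k) + q ^ (j * (N - k))))"
  unfolding laurent_reflect_expand[OF assms]
  by (simp add: sum.distrib[symmetric] algebra_simps)

definition palin_sign :: "nat \<Rightarrow> nat \<Rightarrow> complex" where "palin_sign n M = palin_wgt n M (n + M)"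

lemma palin_wgt_0 [simp]: "palin_wgt n M 0 = 1" by (simp add: palin_wgt_def)

lemma palin_sign_square: "palin_sign n M * palin_sign n M = 1"
  using palin_wgt_reflect[of "n + M" n M] by (simp add: palin_sign_def)

lemma palin_wgt_reflect_sign: "k \<le> n + M \<Longrightarrow> palin_wgt n M (n + M - k) = palin_sign n M * palin_wgt n M k"
  unfolding palin_sign_def by (rule palin_wgt_reflect)

text \<open>The functions of the last variable to which both sides of the identity belong.\<close>

definition wspan :: "nat \<Rightarrow> nat \<Rightarrow> (complex \<Rightarrow> complex) \<Rightarrow> bool" where
  "wspan n M f \<longleftrightarrow> (\<exists>p. degree p \<le> 2 * M \<and> (\<forall>t. f t = (\<Sum>k\<le>n + M. wgt n M k * poly p (q ^ k) * t ^ k)))"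

lemma wspan_diff_scale:
  assumes "wspan n M f" "wspan n M g"
  shows "wspan n M (\<lambda>t. a * f t - b * g t)"
proof -
  obtain p r where p: "degree p \<le> 2 * M" "\<And>t. f t = (\<Sum>k\<le>n + M. wgt n M k * poly p (q ^ k) * t ^ k)"
    and r: "degree r \<le> 2 * M" "\<And>t. g t = (\<Sum>k\<le>n + M. wgt n M k * poly r (q ^ k) * t ^ k)"
    using assms unfolding wspan_def by blast
  have "degree (smult a p - smult b r) \<le> 2 * M"
    using p(1) r(1) by (intro degree_diff_le order.trans[OF degree_smult_le]) auto
  moreover have "a * f t - b * g t = (\<Sum>k\<le>n + M. wgt n M k * poly (smult a p - smult b r) (q ^ k) * t ^ k)" for t
    unfolding p(2) r(2) by (simp add: sum_distrib_left sum_subtractf[symmetric] algebra_simps)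
  ultimately show ?thesis unfolding wspan_def by blast
qed

lemma reflect_sum:
  assumes "t \<noteq> (0::complex)"
  shows "t ^ N * (\<Sum>k\<le>N. c k * (1 / t) ^ k) = (\<Sum>k\<le>N. c (N - k) * t ^ k)"
proof -
  have "t ^ N * (\<Sum>k\<le>N. c k * (1 / t) ^ k) = (\<Sum>k\<le>N. c k * t ^ (N - k))"
    using assms by (auto simp: sum_distrib_left power_diff power_divide intro!: sum.cong)
  also have "\<dots> = (\<Sum>k\<le>N. c (N - k) * t ^ (N - (N - k)))" by (rule sum_atMost_reverse)
  finally show ?thesis by simp
qed

text \<open>The difference of \<open>H x\<close> and its reflection lies in the space spanned by the \<open>M\<close> antisymmetric
combinations and vanishes at the \<open>M\<close> points \<open>x i\<close>.\<close>

lemma wspan_reflection: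
  fixes H :: "(nat \<Rightarrow> complex) \<Rightarrow> complex \<Rightarrow> complex"
  assumes I: "finite I" "card I = M"
    and span: "\<And>x. (\<forall>i\<in>I. x i \<noteq> 0) \<Longrightarrow> wspan n M (H x)"
    and zero: "\<And>x i. (\<forall>i\<in>I. x i \<noteq> 0) \<Longrightarrow> i \<in> I \<Longrightarrow> H x (x i) = 0 \<and> H x (1 / x i) = 0"
    and cont: "\<And>x i t. i \<in> I \<Longrightarrow> continuous_on UNIV (\<lambda>z. H (x(i := z)) t)"
    and t: "t \<noteq> 0"
  shows "H x t = palin_sign n M * t ^ (n + M) * H x (1 / t)"
proof -
  let ?N = "n + M"
  define h where "h = (\<lambda>x t. H x t - palin_sign n M * t ^ ?N * H x (1 / t))"
  define b where "b = (\<lambda>j. \<Sum>k\<le>?N. monom (palin_wgt n M k * (q ^ (j * k) - q ^ (j * (?N - k)))) k)"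
  have "h x t = 0"
  proof (rule generic_interpolation_zero[where h = h and b = b, OF I(1) finite_atLeastAtMost[of 1 M]])
    show "card {1..M} = card I" using I by simp
    show "\<exists>c. \<forall>t. t \<noteq> 0 \<longrightarrow> h x t = (\<Sum>j\<in>{1..M}. c j * poly (b j) t)" if nz: "\<forall>i\<in>I. x i \<noteq> 0" for x
    proof -
      obtain p where p: "degree p \<le> 2 * M" "\<And>t. H x t = (\<Sum>k\<le>?N. wgt n M k * poly p (q ^ k) * t ^ k)"
        using span[OF nz] unfolding wspan_def by blast
      define c where "c = (\<lambda>j. coeff p (M + j) - coeff p (M - j) / q ^ (j * ?N))"
      have "h x t = (\<Sum>j\<in>{1..M}. c j * poly (b j) t)" if "t \<noteq> 0" for t
      proof -
        have ref: "t ^ ?N * H x (1 / t) = (\<Sum>k\<le>?N. wgt n M (?N - k) * poly p (q ^ (?N - k)) * t ^ k)"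
          unfolding p(2) by (rule reflect_sum[OF that])
        have "h x t = (\<Sum>k\<le>?N. (wgt n M k * poly p (q ^ k) - palin_sign n M * (wgt n M (?N - k) * poly p (q ^ (?N - k)))) * t ^ k)"
          unfolding h_def p(2)[of t] mult.assoc[of "palin_sign n M"] ref
          by (simp add: sum_distrib_left sum_subtractf[symmetric] algebra_simps)
        also have "\<dots> = (\<Sum>k\<le>?N. (\<Sum>j\<in>{1..M}. c j * (palin_wgt n M k * (q ^ (j * k) - q ^ (j * (?N - k))))) * t ^ k)"
        proof (intro sum.cong refl arg_cong2[where f="(*)"])
          fix k assume "k \<in> {..?N}"
          then have k: "k \<le> ?N" by simp
          have "wgt n M k * poly p (q ^ k) - palin_sign n M * (wgt n M (?N - k) * poly p (q ^ (?N - k))) =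
            palin_wgt n M k * laurent M p k - (palin_sign n M * palin_sign n M) * palin_wgt n M k * laurent M p (?N - k)"
            unfolding wgt_poly_laurent palin_wgt_reflect_sign[OF k] by (simp only: mult_ac)
          also have "\<dots> = palin_wgt n M k * (laurent M p k - laurent M p (?N - k))"
            unfolding palin_sign_square by (simp add: algebra_simps)
          finally show "wgt n M k * poly p (q ^ k) - palin_sign n M * (wgt n M (?N - k) * poly p (q ^ (?N - k))) =
             (\<Sum>j\<in>{1..M}. c j * (palin_wgt n M k * (q ^ (j * k) - q ^ (j * (?N - k)))))"
            unfolding laurent_antisym[OF p(1) k] c_def by (simp add: sum_distrib_left mult_ac)
        qed
        also have "\<dots> = (\<Sum>j\<in>{1..M}. c j * poly (b j) t)"
          unfolding b_def poly_sum_monom sum_distrib_left sum_distrib_right by (subst sum.swap) (simp add: mult_ac)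
        finally show ?thesis .
      qed
      then show ?thesis by blast
    qed
    show "h x (x i) = 0" if "\<forall>i\<in>I. x i \<noteq> 0" "i \<in> I" for x i
      using zero[OF that] by (simp add: h_def)
    show "continuous_on UNIV (\<lambda>z. h (x(i := z)) t)" if "i \<in> I" for x i t
      unfolding h_def by (intro continuous_intros cont that)
    show "t \<noteq> 0" by (rule t)
  qed
  then show ?thesis by (simp add: h_def)
qed

text \<open>By \<open>wspan_reflection\<close> only the \<open>M + 1\<close> symmetric combinations remain. The value zero at \<open>t = 0\<close>
eliminates the constant one, and \<open>M\<close> of them remain for \<open>M\<close> zeros.\<close>

lemma wspan_eq_0:
  fixes H :: "(nat \<Rightarrow> complex) \<Rightarrow> complex \<Rightarrow> complex"
  assumes I: "finite I" "card I = M"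
    and span: "\<And>x. (\<forall>i\<in>I. x i \<noteq> 0) \<Longrightarrow> wspan n M (H x)"
    and zero: "\<And>x i. (\<forall>i\<in>I. x i \<noteq> 0) \<Longrightarrow> i \<in> I \<Longrightarrow> H x (x i) = 0 \<and> H x (1 / x i) = 0"
    and cont: "\<And>x i t. i \<in> I \<Longrightarrow> continuous_on UNIV (\<lambda>z. H (x(i := z)) t)"
    and at0: "\<And>x. H x 0 = 0"
    and t: "t \<noteq> 0"
  shows "H x t = 0"
proof -
  let ?N = "n + M"
  define b where "b = (\<lambda>j. \<Sum>k\<le>?N. monom (palin_wgt n M k * (q ^ (j * k) + q ^ (j * (?N - k)) - (1 + q ^ (j * ?N)))) k)"
  show ?thesis
  proof (rule generic_interpolation_zero[where h = H and b = b, OF I(1) finite_atLeastAtMost[of 1 M]])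
    show "card {1..M} = card I" using I by simp
    show "\<exists>c. \<forall>t. t \<noteq> 0 \<longrightarrow> H x t = (\<Sum>j\<in>{1..M}. c j * poly (b j) t)" if nz: "\<forall>i\<in>I. x i \<noteq> 0" for x
    proof -
      obtain p where p: "degree p \<le> 2 * M" "\<And>t. H x t = (\<Sum>k\<le>?N. wgt n M k * poly p (q ^ k) * t ^ k)"
        using span[OF nz] unfolding wspan_def by blast
      define a where "a = (\<lambda>k. palin_wgt n M k * (laurent M p k + laurent M p (?N - k)))"
      define r where "r = (\<lambda>k. palin_wgt n M k * (laurent M p k - laurent M p (?N - k)))"
      have Hp: "H x t = (\<Sum>k\<le>?N. palin_wgt n M k * laurent M p k * t ^ k)" for t
        unfolding p(2) wgt_poly_laurent ..
      have ref: "palin_sign n M * (t ^ ?N * H x (1 / t)) = (\<Sum>k\<le>?N. palin_wgt n M k * laurent M p (?N - k) * t ^ k)" if "t \<noteq> 0" for t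
      proof -
        have "palin_sign n M * (t ^ ?N * H x (1 / t)) = (\<Sum>k\<le>?N. palin_sign n M * (palin_wgt n M (?N - k) * laurent M p (?N - k) * t ^ k))"
        proof -
          have "t ^ ?N * H x (1 / t) = (\<Sum>k\<le>?N. palin_wgt n M (?N - k) * laurent M p (?N - k) * t ^ k)"
            unfolding Hp by (rule reflect_sum[OF that])
          then show ?thesis by (simp add: sum_distrib_left)
        qed
        also have "\<dots> = (\<Sum>k\<le>?N. (palin_sign n M * palin_sign n M) * palin_wgt n M k * laurent M p (?N - k) * t ^ k)"
          by (intro sum.cong refl) (simp add: palin_wgt_reflect_sign mult_ac)
        finally show ?thesis by (simp add: palin_sign_square)
      qed
      have sym: "H x t = palin_sign n M * (t ^ ?N * H x (1 / t))" if "t \<noteq> 0" for t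
        using wspan_reflection[OF I span zero cont that, of x] by (simp add: mult.assoc)
      \<comment> \<open>The antisymmetric part is a polynomial that is zero off the origin, hence also its constant term is zero.\<close>
      have "(\<Sum>k\<le>?N. r k * t ^ k) = 0" if "t \<notin> {0}" for t
        using sym[of t] ref[of t] that unfolding Hp[of t]
        by (simp add: r_def algebra_simps sum_subtractf)
      then have "(\<Sum>k\<le>?N. r k * 0 ^ k) = 0"
        by (rule continuous_zero_cofinite[where f = "\<lambda>t. \<Sum>k\<le>?N. r k * t ^ k" and B = "{0}", rotated 2])
          (auto intro!: continuous_intros)
      then have "r 0 = 0" by (simp add: sum.atMost_shift)
      moreover have "laurent M p 0 = 0"
        using at0[of x] unfolding Hp by (simp add: sum.atMost_shift)
      ultimately have "laurent M p 0 + laurent M p (?N - 0) = 0" by (simp add: r_def)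
      then have c0: "2 * coeff p M = - (\<Sum>j\<in>{1..M}. (coeff p (M + j) + coeff p (M - j) / q ^ (j * ?N)) * (1 + q ^ (j * ?N)))"
        unfolding laurent_sym[OF p(1) le0] by (simp add: eq_neg_iff_add_eq_0)
      define d where "d = (\<lambda>j. coeff p (M + j) + coeff p (M - j) / q ^ (j * ?N))"
      define c where "c = (\<lambda>j. d j / 2)"
      have "H x t = (\<Sum>j\<in>{1..M}. c j * poly (b j) t)" if "t \<noteq> 0" for t
      proof -
        have "2 * H x t = (\<Sum>k\<le>?N. a k * t ^ k)"
          using sym[OF that] ref[OF that] unfolding Hp[of t] a_def
          by (simp add: algebra_simps sum.distrib)
        also have "\<dots> = (\<Sum>k\<le>?N. (\<Sum>j\<in>{1..M}. 2 * c j * (palin_wgt n M k * (q ^ (j * k) + q ^ (j * (?N - k)) - (1 + q ^ (j * ?N))))) * t ^ k)"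
        proof (intro sum.cong refl arg_cong2[where f="(*)"])
          fix k assume "k \<in> {..?N}"
          then have k: "k \<le> ?N" by simp
          show "a k = (\<Sum>j\<in>{1..M}. 2 * c j * (palin_wgt n M k * (q ^ (j * k) + q ^ (j * (?N - k)) - (1 + q ^ (j * ?N)))))"
          proof -
            have "a k = palin_wgt n M k * (- (\<Sum>j\<in>{1..M}. d j * (1 + q ^ (j * ?N))) + (\<Sum>j\<in>{1..M}. d j * (q ^ (j * k) + q ^ (j * (?N - k)))))"
              unfolding a_def laurent_sym[OF p(1) k] c0 d_def ..
            also have "\<dots> = palin_wgt n M k * (\<Sum>j\<in>{1..M}. d j * (q ^ (j * k) + q ^ (j * (?N - k)) - (1 + q ^ (j * ?N))))"
              unfolding right_diff_distrib[of "d _"] sum_subtractf by simp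
            finally show ?thesis by (simp add: sum_distrib_left c_def mult_ac)
          qed
        qed
        also have "\<dots> = 2 * (\<Sum>j\<in>{1..M}. c j * poly (b j) t)"
          unfolding b_def poly_sum_monom sum_distrib_left sum_distrib_right by (subst sum.swap) (simp add: mult_ac del: distrib_left_numeral right_diff_distrib_numeral)
        finally show ?thesis by simp
      qed
      then show ?thesis by blast
    qed
    show "H x (x i) = 0" if "\<forall>i\<in>I. x i \<noteq> 0" "i \<in> I" for x i
      using zero[OF that] by simp
    show "continuous_on UNIV (\<lambda>z. H (x(i := z)) t)" if "i \<in> I" for x i t
      by (rule cont[OF that])
    show "t \<noteq> 0" by (rule t)
  qed
qed

section \<open>The alternating sum on the right-hand side\<close>

text \<open>Up to a factor depending on \<open>a\<close> and one depending on \<open>b\<close> this is the difference of the values of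
\<open>q\<^sup>k + q\<^bsup>N-k\<^esup>\<close> at \<open>b\<close> and \<open>a\<close>; it is therefore compatible with \<open>k \<mapsto> N - k\<close>.\<close>

definition g_kernel :: "nat \<Rightarrow> nat \<Rightarrow> nat \<Rightarrow> complex" where
  "g_kernel N a b = (q ^ b - q ^ a) * (1 - q powi (int a + int b - int N))"

lemma g_kernel_skew: "g_kernel N a b = - g_kernel N b a"
  by (simp add: g_kernel_def algebra_simps)

lemma g_kernel_alt: "g_kernel N a b = (q ^ b - q ^ a) * (q ^ N - q ^ (a + b)) / q ^ N"
  unfolding g_kernel_def using one_minus_q_powi[of "a + b" N] by simp

definition gsum :: "nat \<Rightarrow> nat \<Rightarrow> nat set \<Rightarrow> (nat \<Rightarrow> complex) \<Rightarrow> complex" where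
  "gsum n M I x = altsum (g_kernel (n + M)) (wgt n M) (n + M) I x"

definition gslice :: "nat \<Rightarrow> nat \<Rightarrow> nat set \<Rightarrow> (nat \<Rightarrow> complex) \<Rightarrow> nat \<Rightarrow> complex" where
  "gslice n M I x k = (\<Sum>K\<in>PiE I (\<lambda>_. {0..n + M}). pairprod I (\<lambda>i j. g_kernel (n + M) (K i) (K j)) *
     (\<Prod>i\<in>I. wgt n M (K i) * x i ^ K i) * (\<Prod>i\<in>I. g_kernel (n + M) (K i) k))"

lemma gsum_insert_max:
  assumes "finite I" "\<forall>i\<in>I. i < m"
  shows "gsum n M (insert m I) x = (\<Sum>k\<le>n + M. wgt n M k * x m ^ k * gslice n M I x k)"
  unfolding gsum_def altsum_insert_max[OF assms] gslice_def ..

lemma gslice_poly: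
  assumes "finite I" "card I = M"
  shows "\<exists>p. degree p \<le> 2 * M \<and> (\<forall>k. gslice n M I x k = poly p (q ^ k))"
proof -
  define N where "N = n + M"
  define T where "T = (\<lambda>K. pairprod I (\<lambda>i j. g_kernel N (K i) (K j)) * (\<Prod>i\<in>I. wgt n M (K i) * x i ^ K i))"
  define p where "p = (\<Sum>K\<in>PiE I (\<lambda>_. {0..N}). smult (T K) (\<Prod>i\<in>I. [:- (q ^ K i), 1:] * [:1, - (q ^ K i / q ^ N):]))"
  have "degree p \<le> 2 * M"
    unfolding p_def
  proof (intro degree_sum_le order.trans[OF degree_smult_le])
    show "finite (PiE I (\<lambda>_. {0..N}))" using assms by (intro finite_PiE) auto
    fix K :: "nat \<Rightarrow> nat"
    have "degree (\<Prod>i\<in>I. [:- (q ^ K i), 1:] * [:1, - (q ^ K i / q ^ N):]) \<le>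
       sum (degree \<circ> (\<lambda>i. [:- (q ^ K i), 1:] * [:1, - (q ^ K i / q ^ N):])) I"
      by (rule degree_prod_sum_le[OF assms(1)])
    also have "\<dots> \<le> (\<Sum>i\<in>I. 2)"
    proof (rule sum_mono)
      fix i
      show "(degree \<circ> (\<lambda>i. [:- (q ^ K i), 1:] * [:1, - (q ^ K i / q ^ N):])) i \<le> 2"
        unfolding o_def by (rule order.trans[OF degree_mult_le]) simp
    qed
    finally show "degree (\<Prod>i\<in>I. [:- (q ^ K i), 1:] * [:1, - (q ^ K i / q ^ N):]) \<le> 2 * M"
      using assms by simp
  qed
  moreover have "gslice n M I x k = poly p (q ^ k)" for k
  proof -
    have "g_kernel N a k = (q ^ k - q ^ a) * (1 - q ^ k * (q ^ a / q ^ N))" for a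
      unfolding g_kernel_alt by (simp add: field_simps power_add)
    then have "(\<Prod>i\<in>I. g_kernel N (K i) k) = poly (\<Prod>i\<in>I. [:- (q ^ K i), 1:] * [:1, - (q ^ K i / q ^ N):]) (q ^ k)" for K
      unfolding poly_prod poly_mult by simp
    then show ?thesis unfolding gslice_def p_def T_def N_def[symmetric] by (simp add: poly_sum)
  qed
  ultimately show ?thesis by blast
qed

lemma gsum_wspan:
  assumes "finite I" "\<forall>i\<in>I. i < m" "card I = M"
  shows "wspan n M (\<lambda>t. gsum n M (insert m I) (x(m := t)))"
proof -
  obtain p where p: "degree p \<le> 2 * M" "\<And>k. gslice n M I x k = poly p (q ^ k)"
    using gslice_poly[OF assms(1,3)] by blast
  have cong: "gslice n M I (x(m := t)) k = gslice n M I x k" for k t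
    unfolding gslice_def using assms(2) by (intro sum.cong refl arg_cong2[where f="(*)"] prod.cong) auto
  show ?thesis unfolding wspan_def
    by (intro exI[of _ p] conjI p(1)) (simp add: gsum_insert_max[OF assms(1,2)] cong p(2) mult_ac)
qed

text \<open>Replacing \<open>k\<close> by \<open>n + M - k\<close> in the last index multiplies each of the \<open>M\<close> kernel factors by a power
of \<open>q\<close>, and these powers are those that distinguish \<open>wgt\<close> from \<open>palin_wgt\<close>.\<close>

lemma gsum_reflect:
  assumes "finite I" "\<forall>i\<in>I. i < m" "card I = M" "t \<noteq> 0"
  shows "gsum n M (insert m I) (x(m := t)) = palin_sign n M * (t ^ (n + M) * gsum n M (insert m I) (x(m := 1 / t)))"
proof -
  let ?N = "n + M"
  have cong: "gslice n M I (x(m := t)) k = gslice n M I x k" for k t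
    unfolding gslice_def using assms(2) by (intro sum.cong refl arg_cong2[where f="(*)"] prod.cong) auto
  have g: "gsum n M (insert m I) (x(m := t)) = (\<Sum>k\<le>?N. (wgt n M k * gslice n M I x k) * t ^ k)" for t
    unfolding gsum_insert_max[OF assms(1,2)] cong by (simp add: mult_ac)
  have sl: "q ^ (M * k) * gslice n M I x (?N - k) = q ^ (M * (?N - k)) * gslice n M I x k" if k: "k \<le> ?N" for k
  proof -
    have kk: "q ^ k * g_kernel ?N a (?N - k) = q ^ (?N - k) * g_kernel ?N a k" for a
    proof -
      define A B where "A = q ^ k" and "B = q ^ (?N - k)"
      have AB: "q ^ ?N = A * B" using k by (simp add: A_def B_def flip: power_add)
      have nz: "A \<noteq> 0" "B \<noteq> 0" by (simp_all add: A_def B_def)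
      show ?thesis unfolding g_kernel_alt power_add[of q a] A_def[symmetric] B_def[symmetric] AB
        using nz by (simp add: field_simps)
    qed
    have "q ^ (M * k) * (\<Prod>i\<in>I. g_kernel ?N (K i) (?N - k)) = q ^ (M * (?N - k)) * (\<Prod>i\<in>I. g_kernel ?N (K i) k)" for K
    proof -
      have "(\<Prod>i\<in>I. q ^ k * g_kernel ?N (K i) (?N - k)) = (\<Prod>i\<in>I. q ^ (?N - k) * g_kernel ?N (K i) k)"
        by (simp only: kk)
      then show ?thesis using assms(3) by (simp add: prod.distrib power_mult[symmetric] mult.commute)
    qed
    then have e: "q ^ (M * k) * (X * (\<Prod>i\<in>I. g_kernel ?N (K i) (?N - k))) = q ^ (M * (?N - k)) * (X * (\<Prod>i\<in>I. g_kernel ?N (K i) k))" for K X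
      by (metis mult.left_commute)
    show ?thesis unfolding gslice_def sum_distrib_left e ..
  qed
  have "palin_sign n M * (t ^ ?N * gsum n M (insert m I) (x(m := 1 / t))) =
     (\<Sum>k\<le>?N. palin_sign n M * (wgt n M (?N - k) * gslice n M I x (?N - k)) * t ^ k)"
    unfolding g reflect_sum[OF assms(4)] by (simp add: sum_distrib_left mult_ac)
  also have "\<dots> = (\<Sum>k\<le>?N. (wgt n M k * gslice n M I x k) * t ^ k)"
  proof (rule sum.cong[OF refl])
    fix k assume "k \<in> {..?N}"
    then have k: "k \<le> ?N" by simp
    have w: "wgt n M k = palin_wgt n M k / q ^ (M * k)" for k by (simp add: palin_wgt_def)
    have s: "gslice n M I x (?N - k) = q ^ (M * (?N - k)) * gslice n M I x k / q ^ (M * k)"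
      using sl[OF k] by (simp add: eq_divide_eq mult_ac)
    have "palin_sign n M * (wgt n M (?N - k) * gslice n M I x (?N - k)) = (palin_sign n M * palin_sign n M) * (palin_wgt n M k / q ^ (M * k) * gslice n M I x k)"
      unfolding w s palin_wgt_reflect_sign[OF k] by simp
    then show "palin_sign n M * (wgt n M (?N - k) * gslice n M I x (?N - k)) * t ^ k = wgt n M k * gslice n M I x k * t ^ k"
      unfolding palin_sign_square w by simp
  qed
  finally show ?thesis unfolding g ..
qed

section \<open>Setting the last variable to zero\<close>

lemma p_kernel_Suc: "p_kernel (Suc a) (Suc b) = p_kernel a b"
proof -
  have "(q * B - q * A) / (q * B + q * A) = (B - A) / (B + A)" for A B
  proof -
    have "q * B - q * A = q * (B - A)" "q * B + q * A = q * (B + A)" by (simp_all add: algebra_simps)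
    then show ?thesis by simp
  qed
  then show ?thesis by (simp add: p_kernel_def)
qed

text \<open>For \<open>x\<^sub>m = 0\<close> the last index is zero, and its kernel factors turn the weight for \<open>n + 1\<close> into the
weight for \<open>n\<close> at the lowered index.\<close>

lemma \<alpha>_lower: "\<alpha> (Suc n) (Suc j) * p_kernel (Suc j) 0 = - \<alpha> n j"
proof (induction j)
  case 0
  have b: "\<beta> (Suc n) = \<beta> n * ((1 + q * q ^ n) / (1 - q * q ^ n))"
    by (simp add: \<beta>_def qpoch_Suc)
  have a: "\<alpha> (Suc n) 0 = \<beta> (Suc n)" "\<alpha> n 0 = \<beta> n" by (simp_all add: \<alpha>_def)
  have nz: "1 - q * q ^ n \<noteq> 0" "1 + q * q ^ n \<noteq> 0" "q * q ^ n + 1 \<noteq> 0" "1 - q \<noteq> 0" "1 + q \<noteq> 0"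
    using one_minus_q_mult_power_nonzero[of 0] one_minus_q_mult_power_nonzero[of n] by (auto simp: add.commute)
  have "\<alpha> (Suc n) (Suc 0) * p_kernel (Suc 0) 0 =
     \<beta> n * ((1 + q * q ^ n) / (1 - q * q ^ n)) * ((q * q ^ n - 1) * (1 + q) / ((1 - q) * (q * q ^ n + 1))) * ((1 - q) / (1 + q))"
    unfolding \<alpha>_Suc a b by (simp add: p_kernel_def)
  also have "\<dots> = - \<beta> n" using nz by (simp add: divide_simps) (simp add: algebra_simps)
  finally show ?case by (simp add: a)
next
  case (Suc j)
  define J N where "J = q ^ j" and "N = q ^ n"
  have k: "p_kernel (Suc (Suc j)) 0 = (1 - q * (q * J)) / (1 + q * (q * J))" "p_kernel (Suc j) 0 = (1 - q * J) / (1 + q * J)"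
    by (simp_all add: p_kernel_def J_def)
  have nz: "1 - q * J \<noteq> 0" "1 + q * J \<noteq> 0" "1 - q * (q * J) \<noteq> 0" "1 + q * (q * J) \<noteq> 0" "N + J \<noteq> 0" "q * N + q * J \<noteq> 0"
    using one_minus_q_mult_power_nonzero[of j] one_minus_q_mult_power_nonzero[of "Suc j"] q_power_add_nonzero[of "Suc n" "Suc j"]
    by (simp_all add: J_def N_def)
  have e: "(q * N - q * J) / (q * N + q * J) = (N - J) / (N + J)"
  proof -
    have "q * N - q * J = q * (N - J)" "q * N + q * J = q * (N + J)" by (simp_all add: algebra_simps)
    then show ?thesis by simp
  qed
  define A where "A = \<alpha> (Suc n) (Suc j)"
  have a1: "\<alpha> (Suc n) (Suc (Suc j)) = A * (((q * N - q * J) / (q * N + q * J)) * ((1 + q * (q * J)) / (1 - q * (q * J))))"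
    unfolding \<alpha>_Suc[of "Suc n" "Suc j"] A_def J_def N_def by simp
  have a2: "\<alpha> n (Suc j) = \<alpha> n j * (((N - J) / (N + J)) * ((1 + q * J) / (1 - q * J)))"
    unfolding \<alpha>_Suc[of n j] J_def N_def by simp
  have "A = - (\<alpha> n j * ((1 + q * J) / (1 - q * J)))"
    using Suc.IH nz unfolding A_def[symmetric] k by (simp add: field_simps)
  then show ?case unfolding a1 a2 k e using nz by (simp add: mult_ac)
qed

lemma psum_at_0:
  assumes "finite I" "\<forall>i\<in>I. i < m"
  shows "psum (Suc n) (insert m I) (x(m := 0)) = \<beta> (Suc n) * ((-1) ^ card I * (\<Prod>i\<in>I. x i)) * psum n I x"
proof -
  define u where "u = (\<lambda>k. \<alpha> (Suc n) k * p_kernel k 0)"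
  have u0: "u 0 = 0" by (simp add: u_def p_kernel_def)
  have a0: "\<alpha> (Suc n) 0 = \<beta> (Suc n)" by (simp add: \<alpha>_def)
  have "psum (Suc n) (insert m I) (x(m := 0)) = \<beta> (Suc n) * altsum p_kernel u (Suc n) I x"
    unfolding psum_def altsum_insert_max_at_0[OF assms] a0 u_def ..
  also have "altsum p_kernel u (Suc n) I x = (\<Prod>i\<in>I. x i) * altsum (\<lambda>a b. p_kernel (Suc a) (Suc b)) (\<lambda>k. u (Suc k)) n I x"
    by (rule altsum_shift[where u = u, OF assms(1) u0])
  also have "altsum (\<lambda>a b. p_kernel (Suc a) (Suc b)) (\<lambda>k. u (Suc k)) n I x =
     1 ^ (card I choose 2) * (-1) ^ card I * altsum p_kernel (\<alpha> n) n I x"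
    by (rule altsum_scale[OF assms(1)]) (auto simp: u_def \<alpha>_lower p_kernel_Suc)
  finally show ?thesis by (simp add: psum_def mult_ac del: fun_upd_apply)
qed

text \<open>The quotient of the weights in \<open>wgt_lower\<close>, which does not depend on \<open>j\<close>, computed at \<open>j = 0\<close>.\<close>

definition lower_factor :: "nat \<Rightarrow> nat \<Rightarrow> complex" where
  "lower_factor n M = (q ^ (n + M + 2) - 1) * (q ^ (n + M + 1) - 1) * (q ^ Suc M + q) /
     (q ^ (2 * Suc M) * (q ^ Suc n + 1) * q ^ (n + M + 1))"

lemma wgt_lower:
  "j \<le> n + M \<Longrightarrow> wgt (Suc n) (Suc M) (Suc j) * g_kernel (Suc n + Suc M) (Suc j) 0 = lower_factor n M * wgt n M j"
proof (induction j)
  case 0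
  define X where "X = q ^ (n + M)"
  have k: "g_kernel (Suc n + Suc M) (Suc 0) 0 = (1 - q) * (q * X - 1) / (q * X)"
  proof -
    have "q * q * X - q = q * (q * X - 1)" by (simp add: algebra_simps)
    then show ?thesis unfolding g_kernel_alt by (simp add: X_def mult.assoc)
  qed
  have nz: "1 - q \<noteq> 0" using one_minus_q_mult_power_nonzero[of 0] by simp
  have "wgt (Suc n) (Suc M) (Suc 0) = (q * (q * X) - 1) * (q ^ Suc M + q) / (q ^ (2 * Suc M) * (1 - q) * (q ^ Suc n + 1))"
    unfolding wgt_Suc by (simp add: X_def)
  then show ?case unfolding k lower_factor_def using nz by (simp add: X_def mult_ac)
next
  case (Suc j)
  define J X C N where "J = q ^ j" and "X = q ^ (n + M)" and "C = q ^ M" and "N = q ^ n"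
  have k: "g_kernel (Suc n + Suc M) (Suc (Suc j)) 0 = (1 - q * (q * J)) * (X - J) / X"
    "g_kernel (Suc n + Suc M) (Suc j) 0 = (1 - q * J) * (q * X - J) / (q * X)"
  proof -
    have e: "q * (q * X) - q * (q * J) = q * (q * (X - J))" "q * (q * X) - q * J = q * (q * X - J)" by (simp_all add: algebra_simps)
    have p: "q ^ (Suc n + Suc M) = q * (q * X)" "q ^ Suc (Suc j) = q * (q * J)" "q ^ Suc j = q * J" by (simp_all add: X_def J_def)
    show "g_kernel (Suc n + Suc M) (Suc (Suc j)) 0 = (1 - q * (q * J)) * (X - J) / X"
      "g_kernel (Suc n + Suc M) (Suc j) 0 = (1 - q * J) * (q * X - J) / (q * X)"
      unfolding g_kernel_alt add_0_right p power_0 e by simp_all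
  qed
  have nz: "1 - q * J \<noteq> 0" "1 - q * (q * J) \<noteq> 0" "N + J \<noteq> 0" "q * X - J \<noteq> 0" "X \<noteq> 0" "C \<noteq> 0"
    using one_minus_q_mult_power_nonzero[of j] one_minus_q_mult_power_nonzero[of "Suc j"] q_power_eq_iff[of "Suc (n + M)" j] Suc.prems
    by (simp_all add: J_def N_def X_def C_def)
  define W where "W = wgt (Suc n) (Suc M) (Suc j)"
  have w1: "wgt (Suc n) (Suc M) (Suc (Suc j)) = W * ((q * X - J) * (C + q * J) / (q * C * C * (1 - q * (q * J)) * (N + J)))"
  proof -
    have p: "q ^ (Suc n + Suc M) - q ^ Suc j = q * (q * X - J)" "q ^ Suc M + q ^ Suc (Suc j) = q * (C + q * J)"
      "q ^ Suc n + q ^ Suc j = q * (N + J)"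
      by (simp_all add: X_def J_def C_def N_def algebra_simps)
    have p2: "q ^ (2 * Suc M) = q * (q * (C * C))" "q ^ Suc (Suc j) = q * (q * J)"
      by (simp_all add: C_def J_def power_add mult_2)
    show ?thesis unfolding wgt_Suc[of "Suc n" "Suc M" "Suc j"] W_def p unfolding p2 by simp
  qed
  have w2: "wgt n M (Suc j) = wgt n M j * ((X - J) * (C + q * J) / (C * C * (1 - q * J) * (N + J)))"
    unfolding wgt_Suc[of n M j] by (simp add: X_def J_def C_def N_def power_add mult_2)
  have "W * ((1 - q * J) * (q * X - J) / (q * X)) = lower_factor n M * wgt n M j"
    using Suc.IH Suc.prems unfolding k(2) W_def by simp
  then have W: "W * (q * X - J) = lower_factor n M * wgt n M j * (q * X) / (1 - q * J)"
    using nz by (simp add: eq_divide_eq divide_eq_eq mult_ac)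
  have "W * ((q * X - J) * (C + q * J) / (q * C * C * (1 - q * (q * J)) * (N + J))) * ((1 - q * (q * J)) * (X - J) / X) =
     (W * (q * X - J)) * ((C + q * J) * (X - J) / (q * C * C * (N + J) * X))"
    using nz by (simp add: mult_ac)
  also have "\<dots> = lower_factor n M * (wgt n M j * ((X - J) * (C + q * J) / (C * C * (1 - q * J) * (N + J))))"
    unfolding W using nz by (simp add: mult_ac)
  finally show ?case unfolding w1 w2 k(1) .
qed

lemma g_kernel_Suc: "g_kernel (Suc n + Suc M) (Suc a) (Suc b) = q * g_kernel (n + M) a b"
proof -
  have "q ^ (Suc n + Suc M) - q ^ (Suc a + Suc b) = q * q * (q ^ (n + M) - q ^ (a + b))"
    "q ^ Suc b - q ^ Suc a = q * (q ^ b - q ^ a)" "q ^ (Suc n + Suc M) = q * q * q ^ (n + M)"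
    by (simp_all add: algebra_simps)
  then show ?thesis unfolding g_kernel_alt by simp
qed

text \<open>The kernel factors of a vanishing last index also exclude the top index \<open>n + M + 2\<close>, so that the
range of summation shrinks at both ends.\<close>

lemma gsum_at_0:
  assumes "finite I" "\<forall>i\<in>I. i < m"
  shows "gsum (Suc n) (Suc M) (insert m I) (x(m := 0)) =
     q ^ (card I choose 2) * lower_factor n M ^ card I * (\<Prod>i\<in>I. x i) * gsum n M I x"
proof -
  let ?N = "Suc n + Suc M"
  define u where "u = (\<lambda>k. wgt (Suc n) (Suc M) k * g_kernel ?N k 0)"
  have u0: "u 0 = 0" by (simp add: u_def g_kernel_def)
  have uN: "u (Suc (Suc (n + M))) = 0" by (simp add: u_def g_kernel_def)
  have N: "?N = Suc (Suc (n + M))" by simp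
  have "gsum (Suc n) (Suc M) (insert m I) (x(m := 0)) = altsum (g_kernel ?N) u ?N I x"
    unfolding gsum_def altsum_insert_max_at_0[OF assms] u_def by simp
  also have "\<dots> = (\<Prod>i\<in>I. x i) * altsum (\<lambda>a b. g_kernel ?N (Suc a) (Suc b)) (\<lambda>k. u (Suc k)) (Suc (n + M)) I x"
    by (subst (2) N, rule altsum_shift[where u = u, OF assms(1) u0])
  also have "altsum (\<lambda>a b. g_kernel ?N (Suc a) (Suc b)) (\<lambda>k. u (Suc k)) (Suc (n + M)) I x =
      altsum (\<lambda>a b. g_kernel ?N (Suc a) (Suc b)) (\<lambda>k. u (Suc k)) (n + M) I x"
    by (rule altsum_top[OF assms(1)]) (rule uN)
  also have "\<dots> = q ^ (card I choose 2) * lower_factor n M ^ card I * altsum (g_kernel (n + M)) (wgt n M) (n + M) I x"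
    by (rule altsum_scale[OF assms(1)]) (auto simp only: u_def wgt_lower g_kernel_Suc)
  finally show ?thesis by (simp add: gsum_def mult_ac del: fun_upd_apply)
qed

section \<open>Induction on the number of variables\<close>

definition pairfac :: "nat set \<Rightarrow> (nat \<Rightarrow> complex) \<Rightarrow> complex" where
  "pairfac I x = pairprod I (\<lambda>i j. 1 - x i * x j)"

lemma pairfac_insert_max:
  assumes "finite I" "\<forall>i\<in>I. i < m"
  shows "pairfac (insert m I) (x(m := t)) = pairfac I x * (\<Prod>i\<in>I. 1 - x i * t)"
proof -
  have "pairprod I (\<lambda>i j. 1 - (x(m := t)) i * (x(m := t)) j) = pairfac I x"
    unfolding pairfac_def by (rule pairprod_cong) (use assms in auto)
  moreover have "(\<Prod>i\<in>I. 1 - (x(m := t)) i * (x(m := t)) m) = (\<Prod>i\<in>I. 1 - x i * t)"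
    by (intro prod.cong) (use assms in auto)
  ultimately show ?thesis unfolding pairfac_def pairprod_insert_max[OF assms] by simp
qed

lemma psum_wspan:
  assumes "finite I" "\<forall>i\<in>I. i < m" "card I = M" "M \<le> n" "\<forall>i\<in>I. x i \<noteq> 0"
  shows "wspan n M (\<lambda>t. (\<Prod>i\<in>I. 1 - x i * t) * psum n (insert m I) (x(m := t)))"
proof -
  have cong: "pslice n I (x(m := t)) k = pslice n I x k" for k t
    unfolding pslice_def pterm_def using assms(2) by (intro sum.cong refl arg_cong2[where f="(*)"] prod.cong) auto
  have "psum n (insert m I) (x(m := t)) = (\<Sum>k\<le>n. \<alpha> n k * t ^ k * pslice n I x k)" for t
    unfolding psum_insert_max[OF assms(1,2)] cong by simp
  then show ?thesis unfolding wspan_def using psum_span[OF assms(1,3,4)] assms(5) by simp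
qed

text \<open>The difference \<open>H\<close> of the two sides, as a function of the last variable, satisfies the hypotheses of
\<open>wspan_eq_0\<close>. Its value at zero is controlled by the identity for \<open>(n, M)\<close> and by the relation
between the two constants.\<close>

lemma pairfac_psum_step:
  assumes IH: "\<And>x. pairfac {1..Suc M} x * psum n {1..Suc M} x = c * gsum n M {1..Suc M} x"
    and "M \<le> n"
    and c': "c' * (q ^ (Suc M choose 2) * lower_factor n M ^ Suc M) = \<beta> (Suc n) * (-1) ^ Suc M * c"
  shows "pairfac {1..Suc (Suc M)} x * psum (Suc n) {1..Suc (Suc M)} x = c' * gsum (Suc n) (Suc M) {1..Suc (Suc M)} x"
proof -
  define I m where "I = {1..Suc M}" and "m = Suc (Suc M)"
  have I: "finite I" "\<forall>i\<in>I. i < m" "card I = Suc M" and mI: "m \<notin> I" and ins: "{1..Suc (Suc M)} = insert m I"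
    by (auto simp: I_def m_def)
  define F where "F = (\<lambda>x t. pairfac I x * ((\<Prod>i\<in>I. 1 - x i * t) * psum (Suc n) (insert m I) (x(m := t))))"
  define G where "G = (\<lambda>x t. gsum (Suc n) (Suc M) (insert m I) (x(m := t)))"
  define H where "H = (\<lambda>x t. F x t - c' * G x t)"
  have cont_upd: "continuous_on UNIV (\<lambda>z. altsum \<kappa> u N J ((x(i := z))(m := t)))" if "i \<in> I" for \<kappa> u N J x i t
  proof -
    have "(x(i := z))(m := t) = (x(m := t))(i := z)" for z
      using that mI by (auto simp: fun_upd_twist)
    then show ?thesis using continuous_altsum[of UNIV \<kappa> u N J "x(m := t)" i] by (simp only:)
  qed
  have at0: "H x 0 = 0" for x
  proof -
    have "F x 0 = pairfac I x * (\<beta> (Suc n) * ((-1) ^ Suc M * (\<Prod>i\<in>I. x i)) * psum n I x)"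
      unfolding F_def psum_at_0[OF I(1,2)] I(3) by simp
    also have "\<dots> = (\<beta> (Suc n) * (-1) ^ Suc M * c) * (\<Prod>i\<in>I. x i) * gsum n M I x"
      using IH[of x] unfolding I_def[symmetric] by (simp add: mult_ac)
    also have "\<dots> = c' * (q ^ (Suc M choose 2) * lower_factor n M ^ Suc M * (\<Prod>i\<in>I. x i) * gsum n M I x)"
      unfolding c'[symmetric] by (simp only: mult_ac)
    also have "\<dots> = c' * G x 0"
      unfolding G_def gsum_at_0[OF I(1,2)] I(3) ..
    finally show ?thesis by (simp add: H_def)
  qed
  have Geq: "G x (x i) = 0" if "i \<in> I" for x i
    unfolding G_def gsum_def
    by (rule altsum_eq_0_if_eq[of _ i m]) (use that I mI in \<open>auto intro: g_kernel_skew\<close>)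
  have Peq: "psum (Suc n) (insert m I) (x(m := x i)) = 0" if "i \<in> I" for x i
    unfolding psum_def
    by (rule altsum_eq_0_if_eq[of _ i m]) (use that I mI in \<open>auto intro: p_kernel_skew\<close>)
  have H0: "H x t = 0" if "t \<noteq> 0" for x t
  proof (rule wspan_eq_0[OF I(1) I(3), of "Suc n" H])
    fix x :: "nat \<Rightarrow> complex" assume nz: "\<forall>i\<in>I. x i \<noteq> 0"
    have "Suc M \<le> Suc n" using assms(2) by simp
    from wspan_diff_scale[OF psum_wspan[OF I this nz] gsum_wspan[OF I], of "pairfac I x" c' x]
    show "wspan (Suc n) (Suc M) (H x)" unfolding H_def F_def G_def .
    fix i assume i: "i \<in> I"
    have xi: "x i \<noteq> 0" using nz i by simp
    have "H x (x i) = 0" unfolding H_def F_def using Geq[OF i] Peq[OF i] by simp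
    moreover have "H x (1 / x i) = 0"
    proof -
      have "(\<Prod>j\<in>I. 1 - x j * (1 / x i)) = 0"
        using I(1) i xi by (intro prod_zero) (auto intro!: bexI[of _ i])
      moreover have "G x (1 / x i) = 0"
        using gsum_reflect[OF I, of "1 / x i" "Suc n" x] xi Geq[OF i, of x] unfolding G_def by simp
      ultimately show ?thesis unfolding H_def F_def by simp
    qed
    ultimately show "H x (x i) = 0 \<and> H x (1 / x i) = 0" ..
  next
    fix x :: "nat \<Rightarrow> complex" and i t assume i: "i \<in> I"
    show "continuous_on UNIV (\<lambda>z. H (x(i := z)) t)"
      unfolding H_def F_def G_def psum_def gsum_def pairfac_def
      by (intro continuous_intros cont_upd[OF i] continuous_pairprod continuous_fun_upd_apply I)
  qed (use at0 that in auto)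
  have Hx: "H x t = 0" for x t using H0[of t x] at0[of x] by (cases "t = 0") auto
  have "pairfac {1..Suc (Suc M)} x * psum (Suc n) {1..Suc (Suc M)} x = F x (x m)"
    using pairfac_insert_max[OF I(1,2), of x "x m"] unfolding ins F_def by simp
  also have "\<dots> = c' * G x (x m)" using Hx[of x "x m"] by (simp add: H_def)
  finally show ?thesis unfolding ins G_def by simp
qed

definition rhs_const :: "nat \<Rightarrow> nat \<Rightarrow> complex" where
  "rhs_const n m = (- 1) ^ (m choose 2) * q ^ ((n + 1) * (m choose 2) + 2 * (m choose 3)) *
    (qpoch (- q) q n ^ m / qpoch q q (m + n - 1) ^ m) *
    (\<Prod>i\<in>{1..m}.
       qpoch (q powi (int n + 1 - int m + int i)) q (i - 1) /
       qpoch (- (q powi (2 - int m))) q (i - 1))"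

lemma qpoch_q_add: "qpoch q q a * qpoch (q powi (int a + 1)) q b = qpoch q q (a + b)"
proof -
  have "qpoch (q powi (int a + 1)) q b = (\<Prod>l<b. 1 - q * q ^ (a + l))"
    unfolding qpoch_def by (intro prod.cong refl) (simp add: power_int_add power_add)
  moreover have "qpoch q q (a + b) = qpoch q q a * (\<Prod>l<b. 1 - q * q ^ (a + l))"
    by (induction b) (simp_all add: qpoch_Suc)
  ultimately show ?thesis by simp
qed

lemma rhs_const_1: "rhs_const n (Suc 0) = \<beta> n"
  by (simp add: rhs_const_def \<beta>_def numeral_2_eq_2 numeral_3_eq_3)

text \<open>In the product over \<open>i\<close> the numerators agree for \<open>(n, m)\<close> and \<open>(n + 1, m + 1)\<close> except for the new one,
and the denominators are shifted by one place. What remains is a power of \<open>q\<close>, whose exponent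
vanishes by \<open>2 (m choose 2) = m (m - 1)\<close>.\<close>

lemma rhs_const_step:
  "rhs_const (Suc n) (Suc (Suc M)) * (q ^ (Suc M choose 2) * lower_factor n M ^ Suc M) = \<beta> (Suc n) * (-1) ^ Suc M * rhs_const n (Suc M)"
proof -
  define m where "m = Suc M"
  define b2 b3 where "b2 = (m choose 2)" and "b3 = (m choose 3)"
  define A Q where "A = qpoch (- q) q n" and "Q = qpoch q q (n + M)"
  define A' Q' B' where "A' = qpoch (- q) q (Suc n)" and "Q' = qpoch q q (n + M + 2)" and "B' = qpoch q q (Suc n)"
  define E where "E = 1 + q powi (1 - int m)"
  define num where "num = (\<lambda>i. qpoch (q powi (int n + 1 - int m + int i)) q (i - 1))"
  define den where "den = (\<lambda>i. qpoch (- (q powi (2 - int m))) q (i - 1))"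
  define T where "T = (\<Prod>i\<in>{1..m}. num i / den i)"
  have bin: "Suc m choose 2 = b2 + m" "Suc m choose 3 = b3 + b2"
    by (simp_all add: b2_def b3_def numeral_2_eq_2 numeral_3_eq_3)
  have A': "A' = A * (1 + q ^ Suc n)" by (simp add: A'_def A_def qpoch_Suc)
  have Q': "Q' = Q * (1 - q ^ (n + M + 1)) * (1 - q ^ (n + M + 2))"
    by (simp add: Q'_def Q_def qpoch_Suc)
  have E: "E = (q ^ m + q) / q ^ m" unfolding E_def using one_plus_q_powi[of 1 m] by simp
  have nz: "Q \<noteq> 0" "Q' \<noteq> 0" "B' \<noteq> 0" "q ^ m + q \<noteq> 0" "E \<noteq> 0" "1 + q ^ Suc n \<noteq> 0"
    "1 - q ^ (n + M + 1) \<noteq> 0" "1 - q ^ (n + M + 2) \<noteq> 0"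
    using q_power_add_nonzero[of m 1] q_power_eq_1_iff[of "n + M + 1"] q_power_eq_1_iff[of "n + M + 2"]
    unfolding E by (simp_all add: Q_def Q'_def B'_def del: q_power_eq_1_iff)
  have P': "(\<Prod>i\<in>{1..Suc m}. qpoch (q powi (int (Suc n) + 1 - int (Suc m) + int i)) q (i - 1) /
       qpoch (- (q powi (2 - int (Suc m)))) q (i - 1)) = (Q' / B') * T / E ^ m"
  proof -
    have n': "(\<Prod>i\<in>{1..Suc m}. qpoch (q powi (int (Suc n) + 1 - int (Suc m) + int i)) q (i - 1)) =
       (\<Prod>i\<in>{1..m}. num i) * (Q' / B')"
    proof -
      have "B' * qpoch (q powi (int (Suc n) + 1)) q m = Q'"
        using qpoch_q_add[of "Suc n" m] by (simp add: B'_def Q'_def m_def add_ac)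
      then have "qpoch (q powi (int n + 2)) q m = Q' / B'" using nz by (simp add: field_simps)
      then show ?thesis by (simp add: num_def add_ac algebra_simps)
    qed
    have d': "(\<Prod>i\<in>{1..Suc m}. qpoch (- (q powi (2 - int (Suc m)))) q (i - 1)) = E ^ m * (\<Prod>i\<in>{1..m}. den i)"
    proof -
      have "(\<Prod>i\<in>{1..Suc m}. qpoch (- (q powi (2 - int (Suc m)))) q (i - 1)) =
         (\<Prod>i\<in>{0..m}. qpoch (- (q powi (1 - int m))) q i)"
        by (rule prod.reindex_bij_witness[of _ Suc "\<lambda>i. i - 1"]) auto
      also have "\<dots> = (\<Prod>i\<in>{1..m}. qpoch (- (q powi (1 - int m))) q i)"
        by (rule prod.mono_neutral_right) (auto simp: Suc_le_eq)
      also have "\<dots> = (\<Prod>i\<in>{1..m}. E * den i)"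
      proof (rule prod.cong[OF refl])
        fix i assume "i \<in> {1..m}"
        then have i: "i = Suc (i - 1)" by simp
        have "q powi (1 - int m) * q = q powi (2 - int m)"
          using power_int_add[of q "1 - int m" 1] by simp
        then show "qpoch (- (q powi (1 - int m))) q i = E * den i"
          unfolding den_def E_def using qpoch_Suc_shift[of "- (q powi (1 - int m))" "i - 1"] i by simp
      qed
      finally show ?thesis by (simp add: prod.distrib)
    qed
    show ?thesis unfolding prod_dividef n' d' T_def by (simp add: mult_ac)
  qed
  have X: "A' / Q' * (lower_factor n M / E) = A / Q / q ^ (m + n + M + 1)"
  proof -
    have k: "lower_factor n M = (1 - q ^ (n + M + 2)) * (1 - q ^ (n + M + 1)) * (q ^ m + q) /
     (q ^ m * q ^ m * (1 + q ^ Suc n) * q ^ (n + M + 1))"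
    proof -
      have e: "(X - 1) * (Y - 1) = (1 - X) * (1 - Y)" for X Y :: complex by (simp add: algebra_simps)
      have p: "q ^ (2 * m) = q ^ m * q ^ m" by (simp add: power_add mult_2)
      show ?thesis unfolding lower_factor_def m_def[symmetric] e p add.commute[of "q ^ Suc n"] ..
    qed
    have "q ^ (m + n + M + 1) = q ^ m * q ^ (n + M + 1)" by (simp add: power_add)
    moreover have "A * r / (Q * c * d) * (d * c * v / (u * u * r * w) / (v / u)) = A / Q / (u * w)"
      if "Q \<noteq> 0" "r \<noteq> 0" "c \<noteq> 0" "d \<noteq> 0" "u \<noteq> 0" "v \<noteq> 0" "w \<noteq> 0" for r c d u v w :: complex
      using that by (simp add: field_simps)
    ultimately show ?thesis unfolding A' Q' k E
      using nz by (metis power_not_zero q_nonzero)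
  qed
  define e where "e = (n + 2) * (b2 + m) + 2 * (b3 + b2)"
  have ex: "e + b2 = (n + 1) * b2 + 2 * b3 + (m + n + M + 1) * m"
  proof -
    have "2 * (Suc M choose 2) = Suc M * M" by (induction M) (auto simp: numeral_2_eq_2)
    then have "2 * b2 = m * M" by (simp add: b2_def m_def)
    then show ?thesis by (simp add: e_def m_def algebra_simps)
  qed
  have "rhs_const (Suc n) (Suc m) = (-1) ^ (b2 + m) * q ^ e *
     (A' ^ Suc m / Q' ^ Suc m) * ((Q' / B') * T / E ^ m)"
    unfolding rhs_const_def P' bin A'_def[symmetric] by (simp add: Q'_def e_def m_def add_ac)
  also have "A' ^ Suc m / Q' ^ Suc m = A' / Q' * (A' / Q') ^ m"
    by (simp add: power_divide)
  finally have "rhs_const (Suc n) (Suc m) * (q ^ b2 * lower_factor n M ^ m) = (-1) ^ (b2 + m) *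
     q ^ (e + b2) * (A' / B') * (A' / Q' * (lower_factor n M / E)) ^ m * T"
    using nz by (simp add: power_add power_divide power_mult_distrib mult_ac)
  also have "\<dots> = (A' / B') * (-1) ^ m * ((-1) ^ b2 * q ^ ((n + 1) * b2 + 2 * b3) * (A ^ m / Q ^ m) * T)"
  proof -
    define R g where "R = q ^ (m + n + M + 1)" and "g = (n + 1) * b2 + 2 * b3"
    have "q ^ (g + (m + n + M + 1) * m) = q ^ g * R ^ m" unfolding R_def by (simp only: power_add power_mult)
    moreover have "R \<noteq> 0" by (simp add: R_def)
    ultimately show ?thesis unfolding ex X R_def[symmetric] g_def[symmetric]
      by (simp add: power_add power_divide power_mult_distrib mult_ac)
  qed
  also have "(-1) ^ b2 * q ^ ((n + 1) * b2 + 2 * b3) * (A ^ m / Q ^ m) * T = rhs_const n m"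
    unfolding rhs_const_def b2_def b3_def A_def Q_def T_def num_def den_def by (simp add: m_def add_ac)
  finally show ?thesis unfolding b2_def m_def A'_def B'_def \<beta>_def by simp
qed

lemma pairfac_psum_eq_gsum:
  assumes "M \<le> n"
  shows "pairfac {1..Suc M} x * psum n {1..Suc M} x = rhs_const n (Suc M) * gsum n M {1..Suc M} x"
  using assms
proof (induction M arbitrary: n x)
  case 0
  have "psum n {1} x = (\<Sum>k\<le>n. \<alpha> n k * x 1 ^ k)"
    using psum_insert_max[of "{}" 1 n x] by (simp add: pslice_def pterm_def pairprod_def)
  moreover have "gsum n 0 {1} x = (\<Sum>k\<le>n. wgt n 0 k * x 1 ^ k)"
    using gsum_insert_max[of "{}" 1 n 0 x] by (simp add: gslice_def pairprod_def)
  moreover have "pairfac {1} x = 1" unfolding pairfac_def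
    using pairprod_insert_max[of "{}" 1 "\<lambda>i j. 1 - x i * x j"] by (simp add: pairprod_def[of "{}"])
  ultimately show ?case by (simp add: rhs_const_1 \<alpha>_def sum_distrib_left mult_ac)
next
  case (Suc M)
  then obtain n' where n: "n = Suc n'" "M \<le> n'" by (cases n) auto
  show ?case unfolding n(1)
    by (rule pairfac_psum_step[OF Suc.IH[OF n(2)] n(2) rhs_const_step])
qed

lemma psum_eq_0_if_few:
  assumes "finite I" "Suc n < card I"
  shows "psum n I x = 0"
  unfolding psum_eq
proof (rule sum.neutral, rule ballI)
  fix K assume K: "K \<in> PiE I (\<lambda>_. {0..n})"
  have "\<not> inj_on K I"
  proof
    assume "inj_on K I"
    then have "card I \<le> card {0..n}" using K by (intro card_inj_on_le[of K]) auto
    then show False using assms by simp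
  qed
  then show "pterm n I x K = 0" by (rule pterm_noninj[OF assms(1)])
qed

text \<open>The numbers \<open>min k (n + M - k)\<close> take fewer than \<open>M + 1\<close> values, so two indices are equal or add up to
\<open>n + M\<close>. In both cases their kernel factor is zero.\<close>

lemma gsum_eq_0_if_few:
  assumes "finite I" "card I = Suc M" "n < M"
  shows "gsum n M I x = 0"
  unfolding gsum_def altsum_def
proof (rule sum.neutral, rule ballI)
  let ?N = "n + M"
  fix K assume K: "K \<in> PiE I (\<lambda>_. {0..?N})"
  define f where "f = (\<lambda>i. min (K i) (?N - K i))"
  have "\<not> inj_on f I"
  proof
    assume "inj_on f I"
    then have "card I \<le> card {0..?N div 2}" by (intro card_inj_on_le[of f]) (auto simp: f_def)
    then show False using assms by simp
  qed
  then obtain a b where ab: "a \<in> I" "b \<in> I" "a \<noteq> b" "f a = f b" by (auto simp: inj_on_def)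
  have "K a \<le> ?N" "K b \<le> ?N" using PiE_mem[OF K] ab by auto
  then have "K a = K b \<or> K a + K b = ?N" using ab(4) by (auto simp: f_def min_def split: if_splits)
  then have "g_kernel ?N (K a) (K b) = 0" by (auto simp: g_kernel_alt)
  then have "pairprod I (\<lambda>i j. g_kernel ?N (K i) (K j)) = 0"
    by (intro pairprod_skew_eq_0[OF assms(1) ab(1-3)]) (rule g_kernel_skew)
  then show "pairprod I (\<lambda>i j. g_kernel ?N (K i) (K j)) * (\<Prod>i\<in>I. wgt n M (K i) * x i ^ K i) = 0"
    by simp
qed

lemma P_eq_psum: "P q n m x = psum n {1..m} x"
proof -
  define a where "a = (\<lambda>k. qpoch (- q) q k * qpoch (q powi (- int n)) q k / (qpoch q q k * qpoch (- (q powi (- int n))) q k))"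
  have "psum n {1..m} x = 1 ^ (card {1..m} choose 2) * \<beta> n ^ card {1..m} * altsum p_kernel a n {1..m} x"
    unfolding psum_def by (rule altsum_scale) (auto simp: \<alpha>_def wgt_def a_def mult_ac)
  then show ?thesis
    by (simp add: P_def altsum_def a_def \<beta>_def p_kernel_def pairprod_atLeastAtMost[simplified] power_divide)
qed

end

theorem theorem7p1:
  fixes q :: complex and n m :: nat and x :: "nat \<Rightarrow> complex"
  assumes "generic_q q" and "m \<ge> 1"
  shows "(\<Prod>i\<in>{1..m}. \<Prod>j\<in>{i<..m}. 1 - x i * x j) * P q n m x =
    (- 1) ^ (m choose 2) * q ^ ((n + 1) * (m choose 2) + 2 * (m choose 3)) *
    (qpoch (- q) q n ^ m / qpoch q q (m + n - 1) ^ m) *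
    (\<Prod>i\<in>{1..m}.
       qpoch (q powi (int n + 1 - int m + int i)) q (i - 1) /
       qpoch (- (q powi (2 - int m))) q (i - 1)) *
    (\<Sum>k \<in> PiE {1..m} (\<lambda>_. {0..n + m - 1}).
       (\<Prod>i\<in>{1..m}. \<Prod>j\<in>{i<..m}.
          (q ^ k j - q ^ k i) *
          (1 - q powi (int (k i) + int (k j) + 1 - int m - int n))) *
       (\<Prod>i\<in>{1..m}.
          (qpoch (q powi (1 - int m - int n)) q (k i) * qpoch (- (q powi (2 - int m))) q (k i)) /
          (qpoch q q (k i) * qpoch (- (q powi (- int n))) q (k i)) * x i ^ k i))"
proof -
  interpret generic_base q by standard (rule assms(1))
  obtain M where m: "m = Suc M" using assms(2) by (cases m) auto
  have g: "(\<Sum>k \<in> PiE {1..m} (\<lambda>_. {0..n + m - 1}).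
       (\<Prod>i\<in>{1..m}. \<Prod>j\<in>{i<..m}.
          (q ^ k j - q ^ k i) *
          (1 - q powi (int (k i) + int (k j) + 1 - int m - int n))) *
       (\<Prod>i\<in>{1..m}.
          (qpoch (q powi (1 - int m - int n)) q (k i) * qpoch (- (q powi (2 - int m))) q (k i)) /
          (qpoch q q (k i) * qpoch (- (q powi (- int n))) q (k i)) * x i ^ k i)) =
     gsum n M {1..m} x"
  proof -
    have e: "int a + int b + 1 - int m - int n = int a + int b - int (n + M)" for a b
      by (simp add: m)
    have e2: "1 - int m - int n = - int (n + M)" "2 - int m = 1 - int M" "n + m - 1 = n + M"
      by (simp_all add: m)
    show ?thesis
      unfolding gsum_def altsum_def pairprod_atLeastAtMost g_kernel_def wgt_def e e2 ..
  qed
  have p: "(\<Prod>i\<in>{1..m}. \<Prod>j\<in>{i<..m}. 1 - x i * x j) = pairfac {1..m} x"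
    unfolding pairfac_def pairprod_atLeastAtMost ..
  have "pairfac {1..m} x * psum n {1..m} x = rhs_const n m * gsum n M {1..m} x"
  proof (cases "M \<le> n")
    case True
    then show ?thesis unfolding m by (rule pairfac_psum_eq_gsum)
  next
    case False
    then show ?thesis using psum_eq_0_if_few[of "{1..m}" n x] gsum_eq_0_if_few[of "{1..m}" M n x]
      by (simp add: m)
  qed
  then show ?thesis unfolding g p P_eq_psum rhs_const_def .
qed

end
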